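(* Consider the solution $\alpha_0=3$, $\alpha_1=\alpha_2=0$, $\tau_0=e^{-x^4/12}$, $\tau_1=e^{-x^4/12+x^2/2}$, $\tau_2=e^{-x^4/12-x^2/2}$ of the bilinear fourth Painlevé system, and let $\tau_{m,n}(x)$ denote the evaluation of $\tau_{m,n}\in L$ at this solution. Then $\tau_{m,n}(x)$ is defined for $(m,n)\in\mathbb{Z}^2$ with $m\ge n\ge0$, and can be written as $$\tau_{m,n}(x)=\exp\Big(-\frac{x^4}{12}+\frac{m-2n}{2}x^2\Big)H_{m-n,n}(x)\qquad(m\ge n\ge0)$$ for some polynomials $H_{m,n}(x)$ ($m,n\ge0$). These polynomials are characterized by the Toda equations $$\big(\tfrac12D_x^2+3m\big)H_{m,n}\cdot H_{m,n}=H_{m+1,n}H_{m-1,n},\qquad \big(\tfrac12D_x^2-3n\big)H_{m,n}\cdot H_{m,n}=H_{m,n+1}H_{m,n-1}$$ together with the initial conditions $H_{0,0}=H_{1,0}=H_{0,1}=1$, $H_{1,1}=3x$.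
   Context: Indices mod 3. $D_x^2F\cdot F=2(FF''-F'^2)$. The bilinear fourth Painlevé system is $(D_x^2-xD_x-(\alpha_i-\alpha_{i+1})/3)\tau_i\cdot\tau_{i+1}=0$ ($i=0,1,2$), where $D_x^2F\cdot G=F''G-2F'G'+FG''$, $D_xF\cdot G=F'G-FG'$. Let $L$ be the field of rational functions over $\mathbb{C}$ in independent indeterminates $\alpha_0,\alpha_1,x,\tau_0,\tau_1,\tau_2,\tau_0',\tau_1',\tau_2'$, with $\alpha_2:=3-\alpha_0-\alpha_1$ and derivation $'$: $\alpha_i'=0$, $x'=1$, $(\tau_i)'=\tau_i'$, $(\tau_i')'=\tau_i(F_i''+(F_i')^2)$ where $F_j'=\tau_j'/\tau_j$ and $F_i''=-x(F_{i+1}'-F_{i+2}')-(F_i'-F_{i+1}')(F_i'-F_{i+2}')-(\alpha_{i+1}-\alpha_{i+2})/3$. The extended affine Weyl group of type $A^{(1)}_2$ acts on $L$ by differential automorphisms $s_0,s_1,s_2,\pi$ with $s_i(x)=\pi(x)=x$, $s_i(\alpha_i)=-\alpha_i$, $s_i(\alpha_j)=\alpha_j+\alpha_i$ ($j\neq i$), $\pi(\alpha_j)=\alpha_{j+1}$, $s_i(\tau_i)=(\tau_{i+1}'\tau_{i+2}-\tau_{i+1}\tau_{i+2}'+x\tau_{i+1}\tau_{i+2})/\tau_i$, $s_i(\tau_j)=\tau_j$ ($j\ne i$), $\pi(\tau_j)=\tau_{j+1}$. Put $T_1=\pi s_2s_1$, $T_2=s_1\pi s_2$ and $\tau_{m,n}:=T_1^mT_2^n(\tau_0)\in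 L$. The $H_{m,n}$ are called generalized Hermite polynomials. *)

theory Defs
  imports Complex_Main "HOL-Analysis.Derivative" "HOL-Library.Poly_Mapping" "HOL-Computational_Algebra.Fraction_Field"
    "HOL-Computational_Algebra.Polynomial"
begin

datatype var = A0 | A1 | X | T0 | T1 | T2 | DT0 | DT1 | DT2

fun var_idx :: "var \<Rightarrow> nat" where
  "var_idx A0 = 0" | "var_idx A1 = 1" | "var_idx X = 2" | "var_idx T0 = 3" | "var_idx T1 = 4"
| "var_idx T2 = 5" | "var_idx DT0 = 6" | "var_idx DT1 = 7" | "var_idx DT2 = 8"

lemma var_idx_inj: "var_idx a = var_idx b \<Longrightarrow> a = b"
  by (cases a; cases b; simp)

instantiation var :: linorder
begin
definition less_eq_var :: "var \<Rightarrow> var \<Rightarrow> bool" where "less_eq_var a b = (var_idx a \<le> var_idx b)"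
definition less_var :: "var \<Rightarrow> var \<Rightarrow> bool" where "less_var a b = (var_idx a < var_idx b)"
instance
  by standard (auto simp: less_eq_var_def less_var_def intro: var_idx_inj)
end

definition all_vars :: "var set" where
  "all_vars = {A0, A1, X, T0, T1, T2, DT0, DT1, DT2}"

type_synonym mpoly = "(var \<Rightarrow>\<^sub>0 nat) \<Rightarrow>\<^sub>0 complex"
type_synonym Lfield = "mpoly fract"

definition mvar :: "var \<Rightarrow> mpoly" where
  "mvar v = Poly_Mapping.single (Poly_Mapping.single v 1) 1"

definition mconst :: "complex \<Rightarrow> mpoly" where
  "mconst c = Poly_Mapping.single 0 c"

definition peval :: "(complex \<Rightarrow> 'a::comm_ring_1) \<Rightarrow> (var \<Rightarrow> 'a) \<Rightarrow> mpoly \<Rightarrow> 'a" where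
  "peval c f p = (\<Sum>m\<in>Poly_Mapping.keys p. c (Poly_Mapping.lookup p m) *
      (\<Prod>v\<in>Poly_Mapping.keys (m :: var \<Rightarrow>\<^sub>0 nat). f v ^ Poly_Mapping.lookup m v))"

definition pdiff :: "var \<Rightarrow> mpoly \<Rightarrow> mpoly" where
  "pdiff v p = (\<Sum>(m :: var \<Rightarrow>\<^sub>0 nat)\<in>Poly_Mapping.keys p.
      Poly_Mapping.single (m - Poly_Mapping.single v 1) (Poly_Mapping.lookup p m * of_nat (Poly_Mapping.lookup m v)))"

definition Lof :: "mpoly \<Rightarrow> Lfield" where
  "Lof p = Fraction_Field.Fract p 1"

definition Lconst :: "complex \<Rightarrow> Lfield" where
  "Lconst c = Lof (mconst c)"

definition gen :: "var \<Rightarrow> Lfield" where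
  "gen v = Lof (mvar v)"

definition subst :: "(var \<Rightarrow> Lfield) \<Rightarrow> Lfield \<Rightarrow> Lfield" where
  "subst f q = (SOME y. \<exists>a b. b \<noteq> 0 \<and> q = Fraction_Field.Fract a b \<and> peval Lconst f b \<noteq> 0 \<and>
       y = peval Lconst f a / peval Lconst f b)"

definition pder :: "(var \<Rightarrow> Lfield) \<Rightarrow> mpoly \<Rightarrow> Lfield" where
  "pder d p = (\<Sum>v\<in>all_vars. Lof (pdiff v p) * d v)"

definition Lder :: "(var \<Rightarrow> Lfield) \<Rightarrow> Lfield \<Rightarrow> Lfield" where
  "Lder d q = (SOME y. \<exists>a b. b \<noteq> 0 \<and> q = Fraction_Field.Fract a b \<and>
       y = (pder d a * Lof b - Lof a * pder d b) / (Lof b)^2)"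

definition alpha :: "nat \<Rightarrow> Lfield" where
  "alpha i = (if i mod 3 = 0 then gen A0 else if i mod 3 = 1 then gen A1
              else 3 - gen A0 - gen A1)"

definition tauV :: "nat \<Rightarrow> var" where
  "tauV i = (if i mod 3 = 0 then T0 else if i mod 3 = 1 then T1 else T2)"

definition dtauV :: "nat \<Rightarrow> var" where
  "dtauV i = (if i mod 3 = 0 then DT0 else if i mod 3 = 1 then DT1 else DT2)"

definition tau :: "nat \<Rightarrow> Lfield" where "tau i = gen (tauV i)"
definition dtau :: "nat \<Rightarrow> Lfield" where "dtau i = gen (dtauV i)"
definition xL :: Lfield where "xL = gen X"

definition Fp :: "nat \<Rightarrow> Lfield" where "Fp j = dtau j / tau j"

definition Fpp :: "nat \<Rightarrow> Lfield" where
  "Fpp i = - xL * (Fp (i+1) - Fp (i+2)) - (Fp i - Fp (i+1)) * (Fp i - Fp (i+2))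
           - (alpha (i+1) - alpha (i+2)) / 3"

fun dgen :: "var \<Rightarrow> Lfield" where
  "dgen A0 = 0" | "dgen A1 = 0" | "dgen X = 1"
| "dgen T0 = dtau 0" | "dgen T1 = dtau 1" | "dgen T2 = dtau 2"
| "dgen DT0 = tau 0 * (Fpp 0 + (Fp 0)^2)"
| "dgen DT1 = tau 1 * (Fpp 1 + (Fp 1)^2)"
| "dgen DT2 = tau 2 * (Fpp 2 + (Fp 2)^2)"

definition Dx :: "Lfield \<Rightarrow> Lfield" where "Dx = Lder dgen"

definition s_tau :: "nat \<Rightarrow> nat \<Rightarrow> Lfield" where
  "s_tau i j = (if j mod 3 = i mod 3 then
      (dtau (i+1) * tau (i+2) - tau (i+1) * dtau (i+2) + xL * tau (i+1) * tau (i+2)) / tau i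
    else tau j)"

definition s_alpha :: "nat \<Rightarrow> nat \<Rightarrow> Lfield" where
  "s_alpha i j = (if j mod 3 = i mod 3 then - alpha i else alpha j + alpha i)"

text \<open>Images of the indeterminates under s_i (a differential automorphism, so s_i(tau_j') = (s_i(tau_j))').\<close>
fun s_gen :: "nat \<Rightarrow> var \<Rightarrow> Lfield" where
  "s_gen i A0 = s_alpha i 0" | "s_gen i A1 = s_alpha i 1" | "s_gen i X = xL"
| "s_gen i T0 = s_tau i 0" | "s_gen i T1 = s_tau i 1" | "s_gen i T2 = s_tau i 2"
| "s_gen i DT0 = Dx (s_tau i 0)" | "s_gen i DT1 = Dx (s_tau i 1)" | "s_gen i DT2 = Dx (s_tau i 2)"

fun pi_gen :: "var \<Rightarrow> Lfield" where
  "pi_gen A0 = alpha 1" | "pi_gen A1 = alpha 2" | "pi_gen X = xL"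
| "pi_gen T0 = tau 1" | "pi_gen T1 = tau 2" | "pi_gen T2 = tau 0"
| "pi_gen DT0 = Dx (tau 1)" | "pi_gen DT1 = Dx (tau 2)" | "pi_gen DT2 = Dx (tau 0)"

definition sA :: "nat \<Rightarrow> Lfield \<Rightarrow> Lfield" where "sA i = subst (s_gen i)"
definition piA :: "Lfield \<Rightarrow> Lfield" where "piA = subst pi_gen"

definition Tr1 :: "Lfield \<Rightarrow> Lfield" where "Tr1 = piA \<circ> sA 2 \<circ> sA 1"
definition Tr2 :: "Lfield \<Rightarrow> Lfield" where "Tr2 = sA 1 \<circ> piA \<circ> sA 2"

definition tau_mn :: "nat \<Rightarrow> nat \<Rightarrow> Lfield" where
  "tau_mn m n = (Tr1 ^^ m) ((Tr2 ^^ n) (tau 0))"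

fun seed_tau :: "nat \<Rightarrow> complex \<Rightarrow> complex" where
  "seed_tau i x = (if i = 0 then exp (- (x^4) / 12)
                   else if i = 1 then exp (- (x^4) / 12 + x^2/2)
                   else exp (- (x^4) / 12 - x^2/2))"

fun seed :: "var \<Rightarrow> complex \<Rightarrow> complex" where
  "seed A0 x = 3" | "seed A1 x = 0" | "seed X x = x"
| "seed T0 x = seed_tau 0 x" | "seed T1 x = seed_tau 1 x" | "seed T2 x = seed_tau 2 x"
| "seed DT0 x = deriv (seed_tau 0) x" | "seed DT1 x = deriv (seed_tau 1) x"
| "seed DT2 x = deriv (seed_tau 2) x"

definition seed_eval :: "mpoly \<Rightarrow> complex \<Rightarrow> complex" where
  "seed_eval p x = peval (\<lambda>c. c) (\<lambda>v. seed v x) p"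

definition eval_seed_is :: "Lfield \<Rightarrow> (complex \<Rightarrow> complex) \<Rightarrow> bool" where
  "eval_seed_is q G \<longleftrightarrow> (\<exists>a b. q = Fraction_Field.Fract a b \<and> (\<exists>x. seed_eval b x \<noteq> 0) \<and>
      (\<forall>x. seed_eval a x = G x * seed_eval b x))"

definition toda_hermite :: "(nat \<Rightarrow> nat \<Rightarrow> complex poly) \<Rightarrow> bool" where
  "toda_hermite H \<longleftrightarrow>
     (\<forall>m n. m \<ge> 1 \<longrightarrow>
        H m n * pderiv (pderiv (H m n)) - (pderiv (H m n))^2 + of_nat (3*m) * (H m n)^2
          = H (m+1) n * H (m-1) n) \<and>
     (\<forall>m n. n \<ge> 1 \<longrightarrow>
        H m n * pderiv (pderiv (H m n)) - (pderiv (H m n))^2 - of_nat (3*n) * (H m n)^2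
          = H m (n+1) * H m (n-1))"

definition hermite_init :: "(nat \<Rightarrow> nat \<Rightarrow> complex poly) \<Rightarrow> bool" where
  "hermite_init H \<longleftrightarrow> H 0 0 = 1 \<and> H 1 0 = 1 \<and> H 0 1 = 1 \<and> H 1 1 = [:0, 3:]"

end

theory Submission
  imports Defs "HOL-Computational_Algebra.Field_as_Ring" "HOL-Computational_Algebra.Polynomial_Factorial"
    "HOL-Computational_Algebra.Fundamental_Theorem_Algebra" "HOL-Complex_Analysis.Laurent_Convergence"
begin

text \<open>A solution of the bilinear system in a differential field assigns values to the generators
  of \<open>L\<close>, and the value of \<open>s\<^sub>i(q)\<close> or \<open>\<pi>(q)\<close> at a solution is the value of \<open>q\<close> at the transformed
  solution. So \<open>\<tau>\<^sub>m\<^sub>,\<^sub>n\<close> is evaluated by letting the word \<open>T\<^sub>1\<^sup>m T\<^sub>2\<^sup>n\<close> act on the seed, in the field of formal Laurent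
  series. A reflection \<open>s\<^sub>i\<close> is harmless as long as \<open>\<alpha>\<^sub>i \<noteq> 0\<close>, because \<open>f\<^sub>i = x + F\<^sub>i\<^sub>+\<^sub>1' - F\<^sub>i\<^sub>+\<^sub>2'\<close> satisfies
  \<open>f\<^sub>i' = f\<^sub>i (f\<^sub>i\<^sub>+\<^sub>2 - f\<^sub>i\<^sub>+\<^sub>1) + \<alpha>\<^sub>i\<close>; along the word with \<open>m \<ge> n\<close> no parameter of a reflection vanishes.

  Reflections preserve the form Gaussian times polynomial: the three bilinear equations force the
  orders \<open>k, l\<close> of two of the polynomials at a point to satisfy \<open>(k - l)\<^sup>2 = k + l\<close>, hence all zeros are simple,
  and then two of the equations show that \<open>\<tau>\<^sub>i\<close> divides the numerator of \<open>s\<^sub>i(\<tau>\<^sub>i)\<close>. The Toda equations are the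
  identities \<open>T\<^sub>j(\<tau>\<^sub>0) T\<^sub>j\<^sup>-\<^sup>1(\<tau>\<^sub>0) = (f\<^sub>1 f\<^sub>2 + const) \<tau>\<^sub>0\<^sup>2\<close>, and they determine the
  polynomials because none of these vanishes.\<close>

subsection \<open>Polynomials in the generators\<close>

lemma UNIV_var: "(UNIV :: var set) = all_vars"
proof -
  have "v \<in> all_vars" for v by (cases v) (simp_all add: all_vars_def)
  then show ?thesis by auto
qed

instance var :: finite
  by standard (simp add: UNIV_var all_vars_def)

lemma mvar_power: "mvar v ^ k = Poly_Mapping.single (Poly_Mapping.single v k) 1"
  by (induction k) (simp_all add: mvar_def mult_single single_add[symmetric])

lemma single_eq_mconst_mult: "Poly_Mapping.single m c = mconst c * Poly_Mapping.single m 1"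
  by (simp add: mconst_def mult_single)

lemma mconst_1: "mconst 1 = 1"
  by (simp add: mconst_def)

lemma update_eq_single_add:
  fixes f :: "'b \<Rightarrow>\<^sub>0 'c::comm_monoid_add"
  assumes "a \<notin> Poly_Mapping.keys f"
  shows "Poly_Mapping.update a b f = Poly_Mapping.single a b + f"
  by (rule poly_mapping_eqI)
    (use assms in \<open>auto simp: lookup_update lookup_add lookup_single when_def in_keys_iff\<close>)

lemma poly_mapping_single_add_induct [case_names single add]:
  fixes p :: "'b \<Rightarrow>\<^sub>0 'c::comm_monoid_add"
  assumes single: "\<And>m a. Q (Poly_Mapping.single m a)" and add: "\<And>p q. Q p \<Longrightarrow> Q q \<Longrightarrow> Q (p + q)"
  shows "Q p"
proof (induction p rule: update_induct)
  case const
  then show ?case using single[of _ 0] by simp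
next
  case (update f a b)
  then show ?case by (simp add: update_eq_single_add single add)
qed

text \<open>Every monomial is a product of variables, so constants and variables generate the ring.
  Later facts about values at a point are reduced by this rule to a check on generators.\<close>

lemma mpoly_induct [case_names const var add mult]:
  fixes p :: mpoly
  assumes const: "\<And>c. Q (mconst c)" and var: "\<And>v. Q (mvar v)"
    and add: "\<And>p q. Q p \<Longrightarrow> Q q \<Longrightarrow> Q (p + q)"
    and mult: "\<And>p q. Q p \<Longrightarrow> Q q \<Longrightarrow> Q (p * q)"
  shows "Q p"
proof -
  have pow: "Q (mvar v ^ k)" for v k
    by (induction k) (use const[of 1] mconst_1 in \<open>auto intro: mult var\<close>)
  have mon: "Q (Poly_Mapping.single m 1)" for m :: "var \<Rightarrow>\<^sub>0 nat"
  proof (induction m rule: poly_mapping_single_add_induct)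
    case (single v k)
    then show ?case using pow[of v k] by (simp add: mvar_power)
  next
    case (add m n)
    then show ?case using mult by (metis mult_single mult_1)
  qed
  show ?thesis
  proof (induction p rule: poly_mapping_single_add_induct)
    case (single m c)
    then show ?case using single_eq_mconst_mult[of m c] by (simp add: mult const mon)
  qed (rule add)
qed

text \<open>Multiplicativity of \<open>peval\<close> and the Leibniz rule for \<open>pdiff\<close>
  both compare biadditive maps, so monomials suffice.\<close>

lemma mpoly_bilinear_eqI:
  fixes f g :: "mpoly \<Rightarrow> mpoly \<Rightarrow> 'a::ab_group_add"
  assumes "\<And>p q r. f (p + q) r = f p r + f q r" "\<And>p q r. g (p + q) r = g p r + g q r"
    and "\<And>p q r. f r (p + q) = f r p + f r q" "\<And>p q r. g r (p + q) = g r p + g r q"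
    and "\<And>m n a b. f (Poly_Mapping.single m a) (Poly_Mapping.single n b) =
        g (Poly_Mapping.single m a) (Poly_Mapping.single n b)"
  shows "f p q = g p q"
proof -
  have "f (Poly_Mapping.single m a) q = g (Poly_Mapping.single m a) q" for m a
    by (induction q rule: poly_mapping_single_add_induct) (simp_all add: assms)
  then show ?thesis
    by (induction p rule: poly_mapping_single_add_induct) (simp_all add: assms)
qed

text \<open>Cancellation can make the support of \<open>p + q\<close> smaller than the union of the
  two supports; \<open>h m 0 = 0\<close> lets all three sums run over that union.\<close>

lemma sum_keys_add:
  fixes p q :: "'b \<Rightarrow>\<^sub>0 complex" and h :: "'b \<Rightarrow> complex \<Rightarrow> 'a::comm_monoid_add"
  assumes "\<And>m. h m 0 = 0" "\<And>m a b. h m (a + b) = h m a + h m b"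
  shows "(\<Sum>m\<in>Poly_Mapping.keys (p + q). h m (Poly_Mapping.lookup (p + q) m)) =
    (\<Sum>m\<in>Poly_Mapping.keys p. h m (Poly_Mapping.lookup p m)) +
    (\<Sum>m\<in>Poly_Mapping.keys q. h m (Poly_Mapping.lookup q m))"
proof -
  let ?S = "Poly_Mapping.keys p \<union> Poly_Mapping.keys q"
  have *: "(\<Sum>m\<in>Poly_Mapping.keys r. h m (Poly_Mapping.lookup r m)) =
      (\<Sum>m\<in>?S. h m (Poly_Mapping.lookup r m))" if "Poly_Mapping.keys r \<subseteq> ?S" for r :: "'b \<Rightarrow>\<^sub>0 complex"
    by (rule sum.mono_neutral_left) (use that assms(1) in \<open>auto simp: in_keys_iff\<close>)
  have "(\<Sum>m\<in>Poly_Mapping.keys (p + q). h m (Poly_Mapping.lookup (p + q) m)) =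
      (\<Sum>m\<in>?S. h m (Poly_Mapping.lookup (p + q) m))"
    by (rule *) (rule Poly_Mapping.keys_add)
  also have "\<dots> = (\<Sum>m\<in>?S. h m (Poly_Mapping.lookup p m)) + (\<Sum>m\<in>?S. h m (Poly_Mapping.lookup q m))"
    by (simp add: lookup_add assms(2) sum.distrib)
  finally show ?thesis
    by (simp add: *[of p] *[of q])
qed

text \<open>The structure map is abstract because polynomials in the generators are evaluated in
  three rings: \<open>L\<close>, formal Laurent series and the complex numbers.\<close>

locale complex_algebra =
  fixes C :: "complex \<Rightarrow> 'k::comm_ring_1"
  assumes C_0 [simp]: "C 0 = 0" and C_1 [simp]: "C 1 = 1"
    and C_add: "C (a + b) = C a + C b" and C_mult: "C (a * b) = C a * C b"
begin

lemma C_numeral [simp]: "C (numeral n) = numeral n"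
proof -
  have "C (of_nat k) = of_nat k" for k by (induction k) (simp_all add: C_add)
  from this[of "numeral n"] show ?thesis by simp
qed

lemma peval_add: "peval C f (p + q) = peval C f p + peval C f q"
  unfolding peval_def
  by (rule sum_keys_add[where h = "\<lambda>m c. C c * (\<Prod>v\<in>Poly_Mapping.keys m. f v ^ Poly_Mapping.lookup m v)"])
    (simp_all add: C_add distrib_right)

text \<open>With the product taken over all variables, the exponents of two monomials add without a
  case split on supports.\<close>

lemma peval_single: "peval C f (Poly_Mapping.single m a) = C a * (\<Prod>v\<in>UNIV. f v ^ Poly_Mapping.lookup m v)"
proof -
  have "(\<Prod>v\<in>Poly_Mapping.keys m. f v ^ Poly_Mapping.lookup m v) = (\<Prod>v\<in>UNIV. f v ^ Poly_Mapping.lookup m v)"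
    by (rule prod.mono_neutral_left) (auto simp: in_keys_iff)
  then show ?thesis by (simp add: peval_def)
qed

lemma peval_mult: "peval C f (p * q) = peval C f p * peval C f q"
  by (rule mpoly_bilinear_eqI)
    (simp_all add: peval_add distrib_left distrib_right mult_single peval_single C_mult
      lookup_add power_add prod.distrib mult_ac)

lemma peval_mconst [simp]: "peval C f (mconst c) = C c"
  by (simp add: mconst_def peval_single)

lemma peval_mvar [simp]: "peval C f (mvar v) = f v"
proof -
  have "(\<Prod>w\<in>UNIV. f w ^ Poly_Mapping.lookup (Poly_Mapping.single v (1::nat)) w) =
      (\<Prod>w\<in>{v}. f w ^ Poly_Mapping.lookup (Poly_Mapping.single v (1::nat)) w)"
    by (rule prod.mono_neutral_right) (auto simp: lookup_single when_def)
  then show ?thesis by (simp add: mvar_def peval_single)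
qed

lemma peval_0 [simp]: "peval C f 0 = 0"
  using peval_mconst[of f 0] by (simp add: mconst_def)

lemma peval_1 [simp]: "peval C f 1 = 1"
  using peval_mconst[of f 1] by (simp add: mconst_1)

end

section \<open>Partial derivatives\<close>

lemma pdiff_add: "pdiff v (p + q) = pdiff v p + pdiff v q"
  unfolding pdiff_def
  by (rule sum_keys_add[where h = "\<lambda>m c. Poly_Mapping.single (m - Poly_Mapping.single v 1)
        (c * of_nat (Poly_Mapping.lookup m v))"])
    (simp_all add: distrib_right single_add)

lemma pdiff_single: "pdiff v (Poly_Mapping.single m a) =
    Poly_Mapping.single (m - Poly_Mapping.single v 1) (a * of_nat (Poly_Mapping.lookup m v))"
  by (simp add: pdiff_def)

text \<open>Subtraction of exponents is truncated; a positive exponent of \<open>v\<close> in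
  \<open>m\<close> makes it commute with adding \<open>n\<close>.\<close>

lemma diff_single_1_add:
  fixes m n :: "var \<Rightarrow>\<^sub>0 nat"
  assumes "Poly_Mapping.lookup m v \<noteq> 0"
  shows "m - Poly_Mapping.single v (Suc 0) + n = m + n - Poly_Mapping.single v (Suc 0)"
    and "n + (m - Poly_Mapping.single v (Suc 0)) = n + m - Poly_Mapping.single v (Suc 0)"
  by (rule poly_mapping_eqI, use assms in \<open>auto simp: lookup_add lookup_minus lookup_single when_def\<close>)+

lemma pdiff_mult: "pdiff v (p * q) = pdiff v p * q + p * pdiff v q"
proof (rule mpoly_bilinear_eqI[where f = "\<lambda>p q. pdiff v (p * q)"
      and g = "\<lambda>p q. pdiff v p * q + p * pdiff v q"], goal_cases)
  case (5 m n a b)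
  \<comment> \<open>If the exponent of \<open>v\<close> is zero, both sides vanish through their
    coefficients, whatever the truncated exponent is.\<close>
  have "Poly_Mapping.single (m + n - Poly_Mapping.single v 1) (a * b * of_nat (Poly_Mapping.lookup m v)) =
      Poly_Mapping.single (m - Poly_Mapping.single v 1) (a * of_nat (Poly_Mapping.lookup m v)) *
      Poly_Mapping.single n b"
    by (cases "Poly_Mapping.lookup m v = 0")
      (simp_all add: mult_single diff_single_1_add add.commute[of n m] mult_ac)
  moreover have "Poly_Mapping.single (m + n - Poly_Mapping.single v 1) (a * b * of_nat (Poly_Mapping.lookup n v)) =
      Poly_Mapping.single m a *
      Poly_Mapping.single (n - Poly_Mapping.single v 1) (b * of_nat (Poly_Mapping.lookup n v))"
    by (cases "Poly_Mapping.lookup n v = 0") (simp_all add: mult_single diff_single_1_add mult_ac)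
  moreover have "pdiff v (Poly_Mapping.single m a * Poly_Mapping.single n b) =
      Poly_Mapping.single (m + n - Poly_Mapping.single v 1) (a * b * of_nat (Poly_Mapping.lookup m v)) +
      Poly_Mapping.single (m + n - Poly_Mapping.single v 1) (a * b * of_nat (Poly_Mapping.lookup n v))"
    by (simp add: mult_single pdiff_single lookup_add distrib_left single_add[symmetric])
  ultimately show ?case by (simp add: pdiff_single)
qed (simp_all add: pdiff_add algebra_simps)

section \<open>The field \<open>L\<close> and its derivations\<close>

lemma Lof_add: "Lof (p + q) = Lof p + Lof q"
  and Lof_mult: "Lof (p * q) = Lof p * Lof q"
  and Lof_0 [simp]: "Lof 0 = 0"
  and Lof_1 [simp]: "Lof 1 = 1"
  and Lof_eq_iff: "Lof p = Lof q \<longleftrightarrow> p = q"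
  by (simp_all add: Lof_def Zero_fract_def One_fract_def eq_fract)

interpretation Lconst: complex_algebra Lconst
proof
  show "Lconst (a * b) = Lconst a * Lconst b" for a b
    by (simp add: Lconst_def mconst_def Lof_mult[symmetric] mult_single)
  show "Lconst (a + b) = Lconst a + Lconst b" for a b
    by (simp add: Lconst_def mconst_def Lof_add[symmetric] single_add)
qed (simp_all add: Lconst_def mconst_def)

lemma pder_add: "pder d (p + q) = pder d p + pder d q"
  by (simp add: pder_def pdiff_add Lof_add distrib_right sum.distrib)

lemma pder_mult: "pder d (p * q) = pder d p * Lof q + Lof p * pder d q"
  by (simp add: pder_def pdiff_mult Lof_add Lof_mult distrib_right distrib_left sum.distrib sum_distrib_left
      sum_distrib_right mult_ac)

lemma pder_mconst: "pder d (mconst c) = 0"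
  by (simp add: pder_def mconst_def pdiff_single)

lemma pder_mvar: "pder d (mvar v) = d v"
proof -
  have "pder d (mvar v) = (\<Sum>w\<in>UNIV. if w = v then d w else 0)"
    unfolding pder_def UNIV_var
    by (rule sum.cong) (auto simp: mvar_def pdiff_single lookup_single when_def)
  then show ?thesis by simp
qed

text \<open>\<open>Lder\<close> chooses some representing fraction. Two representations satisfy
  \<open>a * b' = a' * b\<close>; this relation together with its derivative makes the two
  quotient-rule expressions equal.\<close>

lemma Lder_Fract:
  assumes "b \<noteq> 0"
  shows "Lder d (Fraction_Field.Fract a b) = (pder d a * Lof b - Lof a * pder d b) / (Lof b)^2"
  unfolding Lder_def
proof (rule some_equality)
  fix y assume "\<exists>a' b'. b' \<noteq> 0 \<and> Fraction_Field.Fract a b = Fraction_Field.Fract a' b' \<and>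
       y = (pder d a' * Lof b' - Lof a' * pder d b') / (Lof b')^2"
  then obtain a' b' where b': "b' \<noteq> 0" and eq: "Fraction_Field.Fract a b = Fraction_Field.Fract a' b'"
    and y: "y = (pder d a' * Lof b' - Lof a' * pder d b') / (Lof b')^2" by blast
  from eq assms b' have ab: "a * b' = a' * b" by (simp add: eq_fract)
  then have 1: "pder d a * Lof b' + Lof a * pder d b' = pder d a' * Lof b + Lof a' * pder d b"
    by (metis pder_mult)
  from ab have 2: "Lof a * Lof b' = Lof a' * Lof b" by (metis Lof_mult)
  have nz: "Lof b \<noteq> 0" "Lof b' \<noteq> 0" using assms b' Lof_eq_iff[of _ 0] by auto
  have "(pder d a' * Lof b' - Lof a' * pder d b') * (Lof b)^2 =
      (pder d a * Lof b - Lof a * pder d b) * (Lof b')^2"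
    using 1 2 by algebra
  then show "y = (pder d a * Lof b - Lof a * pder d b) / (Lof b)^2"
    using nz by (simp add: y divide_simps mult_ac)
qed (use assms in blast)

subsection \<open>Values at a point of a differential field\<close>

text \<open>\<open>(\<alpha>\<^sub>0, \<alpha>\<^sub>1, \<alpha>\<^sub>2, \<tau>\<^sub>0, \<tau>\<^sub>1, \<tau>\<^sub>2)\<close>; rotating corresponds to \<open>\<pi>\<close>.\<close>

type_synonym 'k state = "'k \<times> 'k \<times> 'k \<times> 'k \<times> 'k \<times> 'k"

fun rot :: "'k state \<Rightarrow> 'k state" where
  "rot (a0, a1, a2, t0, t1, t2) = (a1, a2, a0, t1, t2, t0)"

lemma rot_rot_rot [simp]: "rot (rot (rot S)) = S"
  by (cases S) simp

text \<open>The abstract home of a solution: a field with complex constants and an element of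
  derivative 1. The instance used at the end is the field of formal Laurent series.\<close>

locale differential_field = complex_algebra C for C :: "complex \<Rightarrow> 'k::field" +
  fixes D :: "'k \<Rightarrow> 'k" and x :: 'k
  assumes D_add: "D (a + b) = D a + D b" and D_mult: "D (a * b) = D a * b + a * D b"
    and D_C [simp]: "D (C c) = 0" and D_x [simp]: "D x = 1"
begin

lemma D_0 [simp]: "D 0 = 0" and D_1 [simp]: "D 1 = 0"
  using D_C[of 0] D_C[of 1] by simp_all

lemma D_numeral [simp]: "D (numeral n) = 0"
  using D_C[of "numeral n"] by simp

lemma D_uminus: "D (- a) = - D a"
  using D_add[of a "- a"] by (simp add: eq_neg_iff_add_eq_0 add.commute)

lemma D_diff: "D (a - b) = D a - D b"
  using D_add[of a "- b"] by (simp add: D_uminus)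

lemma D_divide: "D (a / b) = (D a * b - a * D b) / b ^ 2" if "b \<noteq> 0"
  using D_mult[of "a / b" b] that by (simp add: divide_simps power2_eq_square mult_ac)

text \<open>Characteristic zero: a numeral is the image of an invertible complex number.\<close>

lemma numeral_neq_0 [simp]: "(numeral n :: 'k) \<noteq> 0"
proof
  assume "(numeral n :: 'k) = 0"
  then have "C (numeral n) * C (1 / numeral n) = 0" by simp
  then show False unfolding C_mult[symmetric] by simp
qed

text \<open>Regularity and value in a single relation: one fraction whose denominator does not
  vanish at \<open>P\<close> is enough, and no default value at a pole enters.\<close>

definition has_value :: "(var \<Rightarrow> 'k) \<Rightarrow> Lfield \<Rightarrow> 'k \<Rightarrow> bool" where
  "has_value P q y \<longleftrightarrow>
     (\<exists>a b. q = Fraction_Field.Fract a b \<and> peval C P b \<noteq> 0 \<and> y * peval C P b = peval C P a)"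

lemma has_value_unique:
  assumes "has_value P q y" "has_value P q z"
  shows "y = z"
proof -
  obtain a b where ab: "q = Fraction_Field.Fract a b" "peval C P b \<noteq> 0" "y * peval C P b = peval C P a"
    using assms(1) unfolding has_value_def by blast
  obtain c d where cd: "q = Fraction_Field.Fract c d" "peval C P d \<noteq> 0" "z * peval C P d = peval C P c"
    using assms(2) unfolding has_value_def by blast
  have "b \<noteq> 0" "d \<noteq> 0" using ab(2) cd(2) by auto
  then have "a * d = c * b" using ab(1) cd(1) by (simp add: eq_fract)
  then have "peval C P a * peval C P d = peval C P c * peval C P b" by (metis peval_mult)
  then have "(y - z) * (peval C P b * peval C P d) = 0"
    using ab(3) cd(3) by algebra
  then show ?thesis using ab(2) cd(2) by simp
qed

lemma has_value_Lof: "has_value P (Lof p) (peval C P p)"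
  unfolding has_value_def Lof_def by (rule exI[of _ p], rule exI[of _ 1]) simp

lemma has_value_Lconst: "has_value P (Lconst c) (C c)"
  using has_value_Lof[of P "mconst c"] by (simp add: Lconst_def)

lemma has_value_gen: "has_value P (gen v) (P v)"
  using has_value_Lof[of P "mvar v"] by (simp add: gen_def)

lemma has_value_0: "has_value P 0 0" and has_value_1: "has_value P 1 1"
  and has_value_numeral: "has_value P (numeral n) (numeral n)"
  using has_value_Lconst[of P 0] has_value_Lconst[of P 1] has_value_Lconst[of P "numeral n"] by simp_all

lemma has_value_add:
  assumes "has_value P q y" "has_value P r z"
  shows "has_value P (q + r) (y + z)"
proof -
  obtain a b where ab: "q = Fraction_Field.Fract a b" "peval C P b \<noteq> 0" "y * peval C P b = peval C P a"
    using assms(1) unfolding has_value_def by blast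
  obtain c d where cd: "r = Fraction_Field.Fract c d" "peval C P d \<noteq> 0" "z * peval C P d = peval C P c"
    using assms(2) unfolding has_value_def by blast
  have "b \<noteq> 0" "d \<noteq> 0" using ab(2) cd(2) by auto
  then have "q + r = Fraction_Field.Fract (a * d + c * b) (b * d)" by (simp add: ab(1) cd(1))
  moreover have "(y + z) * peval C P (b * d) = peval C P (a * d + c * b)"
    by (simp add: peval_add peval_mult ab(3)[symmetric] cd(3)[symmetric] algebra_simps)
  moreover have "peval C P (b * d) \<noteq> 0" using ab(2) cd(2) by (simp add: peval_mult)
  ultimately show ?thesis unfolding has_value_def by blast
qed

lemma has_value_mult:
  assumes "has_value P q y" "has_value P r z"
  shows "has_value P (q * r) (y * z)"
proof -
  obtain a b where ab: "q = Fraction_Field.Fract a b" "peval C P b \<noteq> 0" "y * peval C P b = peval C P a"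
    using assms(1) unfolding has_value_def by blast
  obtain c d where cd: "r = Fraction_Field.Fract c d" "peval C P d \<noteq> 0" "z * peval C P d = peval C P c"
    using assms(2) unfolding has_value_def by blast
  have "q * r = Fraction_Field.Fract (a * c) (b * d)" by (simp add: ab(1) cd(1))
  moreover have "(y * z) * peval C P (b * d) = peval C P (a * c)"
    by (simp add: peval_mult ab(3)[symmetric] cd(3)[symmetric] algebra_simps)
  moreover have "peval C P (b * d) \<noteq> 0" using ab(2) cd(2) by (simp add: peval_mult)
  ultimately show ?thesis unfolding has_value_def by blast
qed

lemma has_value_uminus: "has_value P (- q) (- y)" if "has_value P q y"
  using has_value_mult[OF has_value_Lconst[of P "-1"] that] has_value_Lconst[of P "-1"]
    C_add[of 1 "-1"] Lconst.C_add[of 1 "-1"]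
  by (simp add: eq_neg_iff_add_eq_0[symmetric] add.commute[of 1])

lemma has_value_diff: "has_value P (q - r) (y - z)" if "has_value P q y" "has_value P r z"
  using has_value_add[OF that(1) has_value_uminus[OF that(2)]] by simp

lemma has_value_inverse:
  assumes "has_value P q y" "y \<noteq> 0"
  shows "has_value P (inverse q) (inverse y)"
proof -
  obtain a b where ab: "q = Fraction_Field.Fract a b" "peval C P b \<noteq> 0" "y * peval C P b = peval C P a"
    using assms(1) unfolding has_value_def by blast
  have "inverse q = Fraction_Field.Fract b a" by (simp add: ab(1))
  moreover have "peval C P a \<noteq> 0" using ab assms(2) by (metis mult_eq_0_iff)
  moreover have "inverse y * peval C P a = peval C P b" using assms(2) by (simp add: ab(3)[symmetric])
  ultimately show ?thesis unfolding has_value_def by blast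
qed

lemma has_value_divide: "has_value P (q / r) (y / z)" if "has_value P q y" "has_value P r z" "z \<noteq> 0"
  using has_value_mult[OF that(1) has_value_inverse[OF that(2,3)]] by (simp add: divide_inverse)

lemma has_value_power2: "has_value P (q\<^sup>2) (y\<^sup>2)" if "has_value P q y"
  using has_value_mult[OF that that] by (simp add: power2_eq_square)

lemmas has_value_intros = has_value_0 has_value_1 has_value_numeral has_value_add has_value_mult has_value_uminus
  has_value_diff has_value_divide has_value_power2 has_value_gen

text \<open>Chain rule: if \<open>d\<close> takes at \<open>P\<close> the derivatives of the
  coordinates of \<open>P\<close>, then evaluation at \<open>P\<close> turns \<open>pder d\<close>
  into \<open>D\<close>. By the Leibniz rule only generators have to be compared.\<close>

lemma has_value_pder:
  assumes "\<And>v. has_value P (d v) (D (P v))"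
  shows "has_value P (pder d p) (D (peval C P p))"
  by (induction p rule: mpoly_induct)
    (auto simp: pder_mconst pder_mvar pder_add pder_mult peval_add peval_mult D_add D_mult
      intro!: has_value_intros assms has_value_Lof)

lemma has_value_Lder:
  assumes "\<And>v. has_value P (d v) (D (P v))" "has_value P q y"
  shows "has_value P (Lder d q) (D y)"
proof -
  obtain a b where ab: "q = Fraction_Field.Fract a b" "peval C P b \<noteq> 0" "y * peval C P b = peval C P a"
    using assms(2) unfolding has_value_def by blast
  have "b \<noteq> 0" using ab(2) by auto
  have y: "y = peval C P a / peval C P b" using ab by (simp add: field_simps)
  show ?thesis
    unfolding ab(1) Lder_Fract[OF \<open>b \<noteq> 0\<close>] y D_divide[OF ab(2)]
    using ab(2) by (intro has_value_intros has_value_pder assms(1) has_value_Lof) auto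
qed

lemma has_value_peval:
  assumes "\<And>v. has_value P (f v) (P' v)"
  shows "has_value P (peval Lconst f p) (peval C P' p)"
  by (induction p rule: mpoly_induct)
    (auto simp: peval_add peval_mult Lconst.peval_add Lconst.peval_mult
      intro!: has_value_intros assms has_value_Lconst)

text \<open>The denominator that is required to make sense of \<^term>\<open>subst f q\<close> is nonzero
  because it has a nonzero value at the point \<^term>\<open>P\<close>.\<close>

lemma has_value_subst:
  assumes f: "\<And>v. has_value P (f v) (P' v)" and q: "has_value P' q y"
  shows "has_value P (subst f q) y"
proof -
  obtain a b where ab: "q = Fraction_Field.Fract a b" "peval C P' b \<noteq> 0" "y * peval C P' b = peval C P' a"
    using q unfolding has_value_def by blast
  have "b \<noteq> 0" using ab(2) by auto
  have nz: "peval Lconst f b \<noteq> 0"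
    using has_value_unique[OF has_value_peval[of P f P' b, OF f]] has_value_0[of P] ab(2) by metis
  have "subst f q = peval Lconst f a / peval Lconst f b"
    unfolding subst_def
  proof (rule some_equality)
    fix z assume "\<exists>a b. b \<noteq> 0 \<and> q = Fraction_Field.Fract a b \<and> peval Lconst f b \<noteq> 0 \<and>
       z = peval Lconst f a / peval Lconst f b"
    then obtain c d where cd: "d \<noteq> 0" "q = Fraction_Field.Fract c d" "peval Lconst f d \<noteq> 0"
       "z = peval Lconst f c / peval Lconst f d" by blast
    have "a * d = c * b" using ab(1) cd(1,2) \<open>b \<noteq> 0\<close> by (simp add: eq_fract)
    then have "peval Lconst f a * peval Lconst f d = peval Lconst f c * peval Lconst f b"
      by (metis Lconst.peval_mult)
    then show "z = peval Lconst f a / peval Lconst f b"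
      using nz cd(3) by (simp add: cd(4) frac_eq_eq mult.commute)
  qed (use ab(1) \<open>b \<noteq> 0\<close> nz in blast)
  moreover have "y = peval C P' a / peval C P' b" using ab by (simp add: field_simps)
  ultimately show ?thesis
    using has_value_divide[OF has_value_peval[of P f P', OF f] has_value_peval[of P f P', OF f] ab(2)] by simp
qed

section \<open>Solutions of the system as points at which elements of \<open>L\<close> are
  evaluated\<close>

definition dlog :: "'k \<Rightarrow> 'k" where "dlog t = D t / t"

text \<open>The right-hand side of the formula for \<open>F_i''\<close>, where
  \<open>u, v, w\<close> stand for \<open>F_i', F_(i+1)', F_(i+2)'\<close> and \<open>b, c\<close>
  for the parameters with indices \<open>i+1, i+2\<close>.\<close>

definition painleve4 :: "'k \<Rightarrow> 'k \<Rightarrow> 'k \<Rightarrow> 'k \<Rightarrow> 'k \<Rightarrow> 'k" where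
  "painleve4 b c u v w = - x * (v - w) - (u - v) * (u - w) - (b - c) / 3"

text \<open>These are the bilinear equations divided by the products of two tau functions and solved
  for the second logarithmic derivatives, the form in which \<open>dgen\<close> prescribes the
  derivatives of \<open>DT0\<close>, \<open>DT1\<close>, \<open>DT2\<close>.\<close>

fun solution :: "'k state \<Rightarrow> bool" where
  "solution (a0, a1, a2, t0, t1, t2) \<longleftrightarrow>
     a0 + a1 + a2 = 3 \<and> D a0 = 0 \<and> D a1 = 0 \<and> D a2 = 0 \<and> t0 \<noteq> 0 \<and> t1 \<noteq> 0 \<and> t2 \<noteq> 0 \<and>
     D (dlog t0) = painleve4 a1 a2 (dlog t0) (dlog t1) (dlog t2) \<and>
     D (dlog t1) = painleve4 a2 a0 (dlog t1) (dlog t2) (dlog t0) \<and>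
     D (dlog t2) = painleve4 a0 a1 (dlog t2) (dlog t0) (dlog t1)"

text \<open>The reflection \<open>s\<^sub>0\<close>; the other two are its conjugates under rotation.\<close>

fun flip :: "'k state \<Rightarrow> 'k state" where
  "flip (a0, a1, a2, t0, t1, t2) =
     (- a0, a1 + a0, a2 + a0, (x + dlog t1 - dlog t2) * t1 * t2 / t0, t1, t2)"

fun point :: "'k state \<Rightarrow> var \<Rightarrow> 'k" where
  "point (a0, a1, a2, t0, t1, t2) A0 = a0"
| "point (a0, a1, a2, t0, t1, t2) A1 = a1"
| "point (a0, a1, a2, t0, t1, t2) X = x"
| "point (a0, a1, a2, t0, t1, t2) T0 = t0"
| "point (a0, a1, a2, t0, t1, t2) T1 = t1"
| "point (a0, a1, a2, t0, t1, t2) T2 = t2"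
| "point (a0, a1, a2, t0, t1, t2) DT0 = D t0"
| "point (a0, a1, a2, t0, t1, t2) DT1 = D t1"
| "point (a0, a1, a2, t0, t1, t2) DT2 = D t2"

lemma solution_rot: "solution (rot S) \<longleftrightarrow> solution S"
  by (cases S) (auto simp: add_ac)

lemma D_D: "D (D t) = t * (D (dlog t) + (dlog t)\<^sup>2)" if "t \<noteq> 0"
  using that by (simp add: dlog_def D_divide power2_eq_square field_simps)

lemma has_value_tau:
  "has_value (point (a0, a1, a2, t0, t1, t2)) (tau 0) t0"
  "has_value (point (a0, a1, a2, t0, t1, t2)) (tau 1) t1"
  "has_value (point (a0, a1, a2, t0, t1, t2)) (tau 2) t2"
  "has_value (point (a0, a1, a2, t0, t1, t2)) (dtau 0) (D t0)"
  "has_value (point (a0, a1, a2, t0, t1, t2)) (dtau 1) (D t1)"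
  "has_value (point (a0, a1, a2, t0, t1, t2)) (dtau 2) (D t2)"
  "has_value (point (a0, a1, a2, t0, t1, t2)) xL x"
  "has_value (point (a0, a1, a2, t0, t1, t2)) (alpha 0) a0"
  "has_value (point (a0, a1, a2, t0, t1, t2)) (alpha 1) a1"
  using has_value_gen[of "point (a0, a1, a2, t0, t1, t2)"]
  by (simp_all add: tau_def tauV_def dtau_def dtauV_def xL_def alpha_def)
     (metis point.simps)+

lemma has_value_alpha_2:
  assumes "a0 + a1 + a2 = 3"
  shows "has_value (point (a0, a1, a2, t0, t1, t2)) (alpha 2) a2"
proof -
  have "a2 = 3 - a0 - a1" using assms by (simp add: algebra_simps)
  moreover have "alpha 2 = 3 - alpha 0 - alpha 1" by (simp add: alpha_def)
  ultimately show ?thesis using has_value_tau(8,9) by (auto intro!: has_value_intros)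
qed

lemma mod3: "tau 3 = tau 0" "tau 4 = tau 1" "dtau 3 = dtau 0" "dtau 4 = dtau 1"
  "alpha 3 = alpha 0" "alpha 4 = alpha 1" "Fp 3 = Fp 0" "Fp 4 = Fp 1"
  by (simp_all add: tau_def tauV_def dtau_def dtauV_def alpha_def Fp_def)

text \<open>The equations of a solution make the values of \<open>dgen\<close> at its point equal to
  the derivatives of the coordinates, so the chain rule for \<open>Lder\<close> applies.\<close>

lemma has_value_Dx:
  assumes "solution S" "has_value (point S) q y"
  shows "has_value (point S) (Dx q) (D y)"
proof -
  obtain a0 a1 a2 t0 t1 t2 where S: "S = (a0, a1, a2, t0, t1, t2)" by (cases S) auto
  have sol: "solution (a0, a1, a2, t0, t1, t2)" using assms(1) S by simp
  then have a: "a0 + a1 + a2 = 3" and nz: "t0 \<noteq> 0" "t1 \<noteq> 0" "t2 \<noteq> 0" by simp_all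
  note intros = has_value_intros has_value_tau has_value_alpha_2[OF a]
  have F: "has_value (point S) (Fp 0) (dlog t0)" "has_value (point S) (Fp 1) (dlog t1)"
    "has_value (point S) (Fp 2) (dlog t2)"
    unfolding S Fp_def dlog_def using nz by (auto simp del: One_nat_def intro!: intros)
  have FF: "has_value (point S) (Fpp 0) (painleve4 a1 a2 (dlog t0) (dlog t1) (dlog t2))"
    "has_value (point S) (Fpp 1) (painleve4 a2 a0 (dlog t1) (dlog t2) (dlog t0))"
    "has_value (point S) (Fpp 2) (painleve4 a0 a1 (dlog t2) (dlog t0) (dlog t1))"
    by (auto simp: Fpp_def painleve4_def mod3 S numeral_2_eq_2[symmetric]
        simp del: One_nat_def intro!: intros F[unfolded S])
  have "has_value (point S) (dgen v) (D (point S v))" for v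
    using sol by (cases v) (auto simp: S D_D[OF nz(1)] D_D[OF nz(2)] D_D[OF nz(3)]
        simp del: One_nat_def intro!: intros F[unfolded S] FF[unfolded S])
  then show ?thesis
    unfolding Dx_def using assms(2) by (rule has_value_Lder)
qed

lemma has_value_piA:
  assumes "solution S" "has_value (point (rot S)) q y"
  shows "has_value (point S) (piA q) y"
  unfolding piA_def
proof (rule has_value_subst[OF _ assms(2)])
  fix v
  obtain a0 a1 a2 t0 t1 t2 where S: "S = (a0, a1, a2, t0, t1, t2)" by (cases S) auto
  have a: "a0 + a1 + a2 = 3" using assms(1) S by simp
  note Dx = has_value_Dx[OF assms(1), unfolded S]
  show "has_value (point S) (pi_gen v) (point (rot S) v)"
    by (cases v) (auto simp: S simp del: One_nat_def intro!: has_value_tau has_value_alpha_2[OF a] Dx)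
qed

definition s1 :: "'k state \<Rightarrow> 'k state" where "s1 S = rot (rot (flip (rot S)))"
definition s2 :: "'k state \<Rightarrow> 'k state" where "s2 S = rot (flip (rot (rot S)))"

lemma flip_tau_eq:
  assumes "t1 \<noteq> 0" "t2 \<noteq> 0"
  shows "(x + dlog t1 - dlog t2) * t1 * t2 / t0 = (D t1 * t2 - t1 * D t2 + x * t1 * t2) / t0"
proof -
  have "(x + dlog t1 - dlog t2) * t1 * t2 = D t1 * t2 - t1 * D t2 + x * t1 * t2"
    using assms by (simp add: dlog_def distrib_right left_diff_distrib)
  then show ?thesis by simp
qed

lemma has_value_sA_1:
  assumes "solution S" "has_value (point (s1 S)) q y"
  shows "has_value (point S) (sA 1 q) y"
  unfolding sA_def
proof (rule has_value_subst[OF _ assms(2)])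
  fix v
  obtain a0 a1 a2 t0 t1 t2 where S: "S = (a0, a1, a2, t0, t1, t2)" by (cases S) auto
  have a: "a0 + a1 + a2 = 3" and nz: "t0 \<noteq> 0" "t1 \<noteq> 0" "t2 \<noteq> 0" using assms(1) S by simp_all
  note intros = has_value_intros has_value_tau has_value_alpha_2[OF a]
  note Dx = has_value_Dx[OF assms(1), unfolded S]
  have "has_value (point S) (s_tau 1 1) ((x + dlog t2 - dlog t0) * t2 * t0 / t1)"
    using nz by (auto simp: s_tau_def mod3 S flip_tau_eq simp del: One_nat_def intro!: intros)
  then show "has_value (point S) (s_gen 1 v) (point (s1 S) v)"
    by (cases v) (auto simp: S s1_def s_alpha_def s_tau_def simp del: One_nat_def intro!: intros Dx)
qed

lemma has_value_sA_2:
  assumes "solution S" "has_value (point (s2 S)) q y"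
  shows "has_value (point S) (sA 2 q) y"
  unfolding sA_def
proof (rule has_value_subst[OF _ assms(2)])
  fix v
  obtain a0 a1 a2 t0 t1 t2 where S: "S = (a0, a1, a2, t0, t1, t2)" by (cases S) auto
  have a: "a0 + a1 + a2 = 3" and nz: "t0 \<noteq> 0" "t1 \<noteq> 0" "t2 \<noteq> 0" using assms(1) S by simp_all
  note intros = has_value_intros has_value_tau has_value_alpha_2[OF a]
  note Dx = has_value_Dx[OF assms(1), unfolded S]
  have "has_value (point S) (s_tau 2 2) ((x + dlog t0 - dlog t1) * t0 * t1 / t2)"
    using nz by (auto simp: s_tau_def mod3 S flip_tau_eq simp del: One_nat_def intro!: intros)
  then show "has_value (point S) (s_gen 2 v) (point (s2 S) v)"
    by (cases v) (auto simp: S s2_def s_alpha_def s_tau_def simp del: One_nat_def intro!: intros Dx)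
qed

subsection \<open>Reflections of solutions\<close>

lemma dlog_mult: "dlog (s * t) = dlog s + dlog t" if "s \<noteq> 0" "t \<noteq> 0"
  using that by (simp add: dlog_def D_mult field_simps)

lemma dlog_divide: "dlog (s / t) = dlog s - dlog t" if "s \<noteq> 0" "t \<noteq> 0"
  using that by (simp add: dlog_def D_divide power2_eq_square field_simps)

text \<open>The symmetric form of the fourth Painleve equation: the bracket is
  \<open>f_2 - f_1\<close>, and the normalization of the parameter sum to 3 reduces the constant
  terms to \<open>a0\<close>.\<close>

lemma solution_D_f:
  assumes "solution (a0, a1, a2, t0, t1, t2)"
  defines "f \<equiv> x + dlog t1 - dlog t2"
  shows "D f = f * (2 * dlog t0 - dlog t1 - dlog t2) + a0"
proof -
  have a2: "a2 = 3 - a0 - a1" using assms(1) by (simp add: algebra_simps)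
  have "D f = 1 + painleve4 a2 a0 (dlog t1) (dlog t2) (dlog t0) - painleve4 a0 a1 (dlog t2) (dlog t0) (dlog t1)"
    using assms(1) by (simp add: f_def D_add D_diff)
  also have "\<dots> = f * (2 * dlog t0 - dlog t1 - dlog t2) + a0"
    by (simp add: painleve4_def f_def a2 field_simps)
  finally show ?thesis .
qed

text \<open>If \<open>f\<close> vanished, so would its derivative, which would then equal
  \<open>a0\<close>.\<close>

lemma solution_f_neq_0:
  assumes "solution (a0, a1, a2, t0, t1, t2)" "a0 \<noteq> 0"
  shows "x + dlog t1 - dlog t2 \<noteq> 0"
  using solution_D_f[OF assms(1)] assms(2) by auto

text \<open>The factor \<open>f\<close> contributes \<open>2 F_0' - F_1' - F_2' + a0 / f\<close> and
  the quotient \<open>t1 t2 / t0\<close> contributes \<open>F_1' + F_2' - F_0'\<close>; only a shift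
  of \<open>F_0'\<close> by \<open>a0 / f\<close> survives.\<close>

lemma dlog_flip:
  assumes "solution (a0, a1, a2, t0, t1, t2)" "a0 \<noteq> 0"
  defines "f \<equiv> x + dlog t1 - dlog t2"
  shows "dlog (f * t1 * t2 / t0) = dlog t0 + a0 / f"
proof -
  have f: "f \<noteq> 0" using solution_f_neq_0[OF assms(1,2)] by (simp add: f_def)
  have "dlog f = 2 * dlog t0 - dlog t1 - dlog t2 + a0 / f"
    using solution_D_f[OF assms(1)] f by (simp add: dlog_def[of f] f_def[symmetric] field_simps)
  then show ?thesis
    using assms(1) f by (simp add: dlog_mult dlog_divide)
qed

text \<open>Only one logarithmic derivative changes, by \<open>g = a0 / f\<close>. The equation for
  it needs the Riccati-type equation of \<open>g\<close>; the other two need just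
  \<open>a0 = g f\<close>.\<close>

lemma solution_flip:
  assumes "solution (a0, a1, a2, t0, t1, t2)" "a0 \<noteq> 0"
  shows "solution (flip (a0, a1, a2, t0, t1, t2))"
proof -
  define f where "f = x + dlog t1 - dlog t2"
  define g where "g = a0 / f"
  define u0 where "u0 = dlog t0"
  define u1 where "u1 = dlog t1"
  define u2 where "u2 = dlog t2"
  have f: "f \<noteq> 0" using solution_f_neq_0[OF assms] by (simp add: f_def)
  \<comment> \<open>Eliminating \<open>a0\<close> in favour of \<open>g\<close> turns the last two
    equations into polynomial identities.\<close>
  have a0: "a0 = g * (x + u1 - u2)" using f by (simp add: g_def f_def u1_def u2_def)
  have Df: "D f = f * (2 * u0 - u1 - u2) + a0"
    using solution_D_f[OF assms(1)] by (simp add: f_def u0_def u1_def u2_def)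
  have "D g = - a0 * D f / f\<^sup>2" using assms(1) f by (simp add: g_def D_divide)
  also have "\<dots> = - g * (2 * u0 - u1 - u2 + g)"
    using f by (simp add: Df g_def field_simps power2_eq_square)
  finally have Dg: "D g = - g * (2 * u0 - u1 - u2 + g)" .
  have dl: "dlog (f * t1 * t2 / t0) = u0 + g"
    using dlog_flip[OF assms] by (simp add: f_def g_def u0_def)
  have sol: "a0 + a1 + a2 = 3" "D a0 = 0" "D a1 = 0" "D a2 = 0" "t0 \<noteq> 0" "t1 \<noteq> 0" "t2 \<noteq> 0"
    "D u0 = painleve4 a1 a2 u0 u1 u2" "D u1 = painleve4 a2 a0 u1 u2 u0" "D u2 = painleve4 a0 a1 u2 u0 u1"
    using assms(1) by (simp_all add: u0_def u1_def u2_def)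
  have "painleve4 a1 a2 u0 u1 u2 + D g = painleve4 (a1 + a0) (a2 + a0) (u0 + g) u1 u2"
    by (simp add: painleve4_def Dg field_simps)
  moreover have "painleve4 a2 a0 u1 u2 u0 = painleve4 (a2 + a0) (- a0) u1 u2 (u0 + g)"
    by (simp add: painleve4_def a0 field_simps)
  moreover have "painleve4 a0 a1 u2 u0 u1 = painleve4 (- a0) (a1 + a0) u2 (u0 + g) u1"
    by (simp add: painleve4_def a0 field_simps)
  moreover have "- a0 + (a1 + a0) + (a2 + a0) = 3" using sol(1) by (simp add: algebra_simps)
  ultimately have "solution (- a0, a1 + a0, a2 + a0, f * t1 * t2 / t0, t1, t2)"
    using sol f by (simp add: dl D_add D_uminus u1_def[symmetric] u2_def[symmetric])
  then show ?thesis by (simp only: flip.simps f_def)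
qed

text \<open>\<open>f\<close> involves only the two tau functions that stay fixed, so both
  applications use the same nonzero \<open>f\<close> and it cancels.\<close>

lemma flip_flip:
  assumes "solution (a0, a1, a2, t0, t1, t2)" "a0 \<noteq> 0"
  shows "flip (flip (a0, a1, a2, t0, t1, t2)) = (a0, a1, a2, t0, t1, t2)"
  using assms(1) solution_f_neq_0[OF assms] by simp

section \<open>Words in the reflections, the braid relation and translations\<close>

lemma s1_eq: "s1 (a0, a1, a2, t0, t1, t2) =
    (a0 + a1, - a1, a2 + a1, t0, (x + dlog t2 - dlog t0) * t2 * t0 / t1, t2)"
  and s2_eq: "s2 (a0, a1, a2, t0, t1, t2) =
    (a0 + a2, a1 + a2, - a2, t0, t1, (x + dlog t0 - dlog t1) * t0 * t1 / t2)"
  by (simp_all add: s1_def s2_def)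

lemma solution_s1:
  assumes "solution (a0, a1, a2, t0, t1, t2)" "a1 \<noteq> 0"
  shows "solution (s1 (a0, a1, a2, t0, t1, t2))"
proof -
  have "solution (rot (a0, a1, a2, t0, t1, t2))" using assms(1) by (simp only: solution_rot)
  from solution_flip[OF this[unfolded rot.simps] assms(2)] show ?thesis
    by (simp only: s1_def solution_rot rot.simps)
qed

lemma solution_s2:
  assumes "solution (a0, a1, a2, t0, t1, t2)" "a2 \<noteq> 0"
  shows "solution (s2 (a0, a1, a2, t0, t1, t2))"
proof -
  have "solution (rot (rot (a0, a1, a2, t0, t1, t2)))" using assms(1) by (simp only: solution_rot)
  from solution_flip[OF this[unfolded rot.simps] assms(2)] show ?thesis
    by (simp only: s2_def solution_rot rot.simps)
qed

lemma s1_s1: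
  assumes "solution (a0, a1, a2, t0, t1, t2)" "a1 \<noteq> 0"
  shows "s1 (s1 (a0, a1, a2, t0, t1, t2)) = (a0, a1, a2, t0, t1, t2)"
proof -
  have "solution (rot (a0, a1, a2, t0, t1, t2))" using assms(1) by (simp only: solution_rot)
  from flip_flip[OF this[unfolded rot.simps] assms(2)] show ?thesis
    by (simp only: s1_def rot_rot_rot rot.simps)
qed

lemma dlog_s1:
  assumes "solution (a0, a1, a2, t0, t1, t2)" "a1 \<noteq> 0"
  shows "dlog ((x + dlog t2 - dlog t0) * t2 * t0 / t1) = dlog t1 + a1 / (x + dlog t2 - dlog t0)"
    and "x + dlog t2 - dlog t0 \<noteq> 0"
proof -
  have "solution (rot (a0, a1, a2, t0, t1, t2))" using assms(1) by (simp only: solution_rot)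
  note * = this[unfolded rot.simps] assms(2)
  show "dlog ((x + dlog t2 - dlog t0) * t2 * t0 / t1) = dlog t1 + a1 / (x + dlog t2 - dlog t0)"
    and "x + dlog t2 - dlog t0 \<noteq> 0"
    by (rule dlog_flip[OF *] solution_f_neq_0[OF *])+
qed

lemma dlog_s2:
  assumes "solution (a0, a1, a2, t0, t1, t2)" "a2 \<noteq> 0"
  shows "dlog ((x + dlog t0 - dlog t1) * t0 * t1 / t2) = dlog t2 + a2 / (x + dlog t0 - dlog t1)"
    and "x + dlog t0 - dlog t1 \<noteq> 0"
proof -
  have "solution (rot (rot (a0, a1, a2, t0, t1, t2)))" using assms(1) by (simp only: solution_rot)
  note * = this[unfolded rot.simps] assms(2)
  show "dlog ((x + dlog t0 - dlog t1) * t0 * t1 / t2) = dlog t2 + a2 / (x + dlog t0 - dlog t1)"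
    and "x + dlog t0 - dlog t1 \<noteq> 0"
    by (rule dlog_flip[OF *] solution_f_neq_0[OF *])+
qed

text \<open>The first reflection raises \<open>F_2'\<close> by \<open>a2 / f2\<close>, so
  \<open>f1\<close> becomes \<open>f1 + a2 / f2\<close>; the factor \<open>f2\<close> in the new
  \<open>t2\<close> clears the denominator. The resulting \<open>f1 f2 + a2\<close> is the germ of
  the Toda right-hand side.\<close>

lemma s1_s2_eq:
  assumes "solution (a0, a1, a2, t0, t1, t2)" "a2 \<noteq> 0"
  shows "s1 (s2 (a0, a1, a2, t0, t1, t2)) =
    (a0 + a1 + 2 * a2, - a1 - a2, a1, t0,
     ((x + dlog t2 - dlog t0) * (x + dlog t0 - dlog t1) + a2) * t0\<^sup>2 / t2,
     (x + dlog t0 - dlog t1) * t0 * t1 / t2)"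
proof -
  define f1 where "f1 = x + dlog t2 - dlog t0"
  define f2 where "f2 = x + dlog t0 - dlog t1"
  note f2 = dlog_s2[OF assms, folded f2_def]
  have e1: "x + (dlog t2 + a2 / f2) - dlog t0 = f1 + a2 / f2" by (simp add: f1_def)
  have e2: "(f1 + a2 / f2) * (f2 * t0 * t1 / t2) * t0 / t1 = (f1 * f2 + a2) * t0\<^sup>2 / t2"
    using assms(1) f2(2) by (simp add: field_simps power2_eq_square)
  show ?thesis
    unfolding s2_eq s1_eq f1_def[symmetric] f2_def[symmetric] f2(1) e1 e2 by (simp add: algebra_simps)
qed

lemma s2_s1_eq:
  assumes "solution (a0, a1, a2, t0, t1, t2)" "a1 \<noteq> 0"
  shows "s2 (s1 (a0, a1, a2, t0, t1, t2)) =
    (a0 + 2 * a1 + a2, a2, - a1 - a2, t0, (x + dlog t2 - dlog t0) * t2 * t0 / t1,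
     ((x + dlog t2 - dlog t0) * (x + dlog t0 - dlog t1) - a1) * t0\<^sup>2 / t1)"
proof -
  define f1 where "f1 = x + dlog t2 - dlog t0"
  define f2 where "f2 = x + dlog t0 - dlog t1"
  note f1 = dlog_s1[OF assms, folded f1_def]
  have e1: "x + dlog t0 - (dlog t1 + a1 / f1) = f2 - a1 / f1" by (simp add: f2_def)
  have e2: "(f2 - a1 / f1) * t0 * (f1 * t2 * t0 / t1) / t2 = (f1 * f2 - a1) * t0\<^sup>2 / t1"
    using assms(1) f1(2) by (simp add: field_simps power2_eq_square)
  show ?thesis
    unfolding s1_eq s2_eq f1_def[symmetric] f2_def[symmetric] f1(1) e1 e2 by (simp add: algebra_simps)
qed

text \<open>Both sides are evaluated by the closed forms for two-letter words, started at
  \<open>s1 S\<close> and \<open>s2 S\<close>. There the second reflection used has parameter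
  \<open>a1 + a2\<close>, whence the third nonvanishing condition.\<close>

lemma braid:
  assumes sol: "solution (a0, a1, a2, t0, t1, t2)" and "a1 \<noteq> 0" "a2 \<noteq> 0" "a1 + a2 \<noteq> 0"
  shows "s1 (s2 (s1 (a0, a1, a2, t0, t1, t2))) = s2 (s1 (s2 (a0, a1, a2, t0, t1, t2)))"
proof -
  have t: "t0 \<noteq> 0" "t1 \<noteq> 0" "t2 \<noteq> 0" using sol by simp_all
  define f1 where "f1 = x + dlog t2 - dlog t0"
  define f2 where "f2 = x + dlog t0 - dlog t1"
  note f1 = dlog_s1[OF sol assms(2), folded f1_def]
  note f2 = dlog_s2[OF sol assms(3), folded f2_def]
  have f2': "x + dlog t0 - (dlog t1 + a1 / f1) = f2 - a1 / f1"
    and f1': "x + (dlog t2 + a2 / f2) - dlog t0 = f1 + a2 / f2"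
    by (simp_all add: f1_def f2_def)
  have 1: "solution (a0 + a1, - a1, a2 + a1, t0, f1 * t2 * t0 / t1, t2)"
    using solution_s1[OF sol assms(2)] by (simp only: s1_eq f1_def)
  have 2: "solution (a0 + a2, a1 + a2, - a2, t0, t1, f2 * t0 * t1 / t2)"
    using solution_s2[OF sol assms(3)] by (simp only: s2_eq f2_def)
  have "a2 + a1 \<noteq> 0" using assms(4) by (simp add: add.commute)
  note e1 = s1_s2_eq[OF 1 this, unfolded f1 f2' f1_def[symmetric]]
  note e2 = s2_s1_eq[OF 2 assms(4), unfolded f2 f1' f2_def[symmetric]]
  show ?thesis
    unfolding s1_eq[of a0 a1 a2 t0 t1 t2, folded f1_def] s2_eq[of a0 a1 a2 t0 t1 t2, folded f2_def] e1 e2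
    using t f1(2) f2(2) by (simp add: field_simps power2_eq_square)
qed

text \<open>The actions of \<open>T\<^sub>1\<close>, \<open>T\<^sub>1 T\<^sub>2\<close> and \<open>T\<^sub>2\<close>. The letters act from left to right,
  since states transform contravariantly to elements of \<open>L\<close>.\<close>

definition move_R :: "'k state \<Rightarrow> 'k state" where "move_R S = s1 (s2 (rot S))"
definition move_U :: "'k state \<Rightarrow> 'k state" where "move_U S = s2 (s1 (rot (rot S)))"
definition move_L :: "'k state \<Rightarrow> 'k state" where "move_L S = s2 (rot (s1 S))"

lemma rot_s1: "rot (s1 S) = flip (rot S)" and rot_s2: "rot (s2 S) = s1 (rot S)"
  by (simp_all add: s1_def s2_def)

lemma rot_flip: "rot (flip S) = s2 (rot S)"
  by (simp add: s2_def)

lemma move_R_eq: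
  assumes "solution (a0, a1, a2, t0, t1, t2)" "a0 \<noteq> 0"
  shows "move_R (a0, a1, a2, t0, t1, t2) =
    (a1 + a2 + 2 * a0, - a2 - a0, a2, t1,
     ((x + dlog t0 - dlog t1) * (x + dlog t1 - dlog t2) + a0) * t1\<^sup>2 / t0,
     (x + dlog t1 - dlog t2) * t1 * t2 / t0)"
proof -
  have "solution (rot (a0, a1, a2, t0, t1, t2))" using assms(1) by (simp only: solution_rot)
  from s1_s2_eq[OF this[unfolded rot.simps] assms(2)] show ?thesis by (simp only: move_R_def rot.simps)
qed

lemma move_U_eq:
  assumes "solution (a0, a1, a2, t0, t1, t2)" "a0 \<noteq> 0"
  shows "move_U (a0, a1, a2, t0, t1, t2) =
    (a2 + 2 * a0 + a1, a1, - a0 - a1, t2, (x + dlog t1 - dlog t2) * t1 * t2 / t0,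
     ((x + dlog t1 - dlog t2) * (x + dlog t2 - dlog t0) - a0) * t2\<^sup>2 / t0)"
proof -
  have "solution (rot (rot (a0, a1, a2, t0, t1, t2)))" using assms(1) by (simp only: solution_rot)
  from s2_s1_eq[OF this[unfolded rot.simps] assms(2)] show ?thesis by (simp only: move_U_def rot.simps)
qed

lemma solution_move_R:
  assumes "solution (a0, a1, a2, t0, t1, t2)" "a0 \<noteq> 0" "a0 + a2 \<noteq> 0"
  shows "solution (s2 (rot (a0, a1, a2, t0, t1, t2)))" "solution (move_R (a0, a1, a2, t0, t1, t2))"
proof -
  have "solution (rot (a0, a1, a2, t0, t1, t2))" using assms(1) by (simp only: solution_rot)
  note * = solution_s2[OF this[unfolded rot.simps] assms(2)]
  then show "solution (s2 (rot (a0, a1, a2, t0, t1, t2)))" by (simp only: rot.simps)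
  have a: "a2 + a0 \<noteq> 0" using assms(3) by (simp add: add.commute)
  show "solution (move_R (a0, a1, a2, t0, t1, t2))"
    using solution_s1[OF *[unfolded s2_eq] a] by (simp only: move_R_def rot.simps s2_eq)
qed

lemma solution_move_U:
  assumes "solution (a0, a1, a2, t0, t1, t2)" "a0 \<noteq> 0" "a0 + a1 \<noteq> 0"
  shows "solution (move_U (a0, a1, a2, t0, t1, t2))"
proof -
  have "solution (rot (rot (a0, a1, a2, t0, t1, t2)))" using assms(1) by (simp only: solution_rot)
  note * = solution_s1[OF this[unfolded rot.simps] assms(2)]
  have "a1 + a0 \<noteq> 0" using assms(3) by (simp add: add.commute)
  from solution_s2[OF *[unfolded s1_eq] this] show ?thesis
    by (simp only: move_U_def rot.simps s1_eq)
qed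

text \<open>Moving all rotations inward turns one composite into \<open>s1 s2 s1\<close> and the
  other into \<open>s2 s1 s2\<close>, both applied to the flipped state, so commutation is the braid
  relation. The conditions are the roots \<open>a0 + a1\<close>, \<open>a0 + a2\<close> and their
  sum after the flip.\<close>

lemma move_R_move_U:
  assumes "solution (a0, a1, a2, t0, t1, t2)" "a0 \<noteq> 0" "a0 + a1 \<noteq> 0" "a0 + a2 \<noteq> 0" "2 * a0 + a1 + a2 \<noteq> 0"
  shows "move_R (move_U (a0, a1, a2, t0, t1, t2)) = move_U (move_R (a0, a1, a2, t0, t1, t2))"
proof -
  let ?S = "(a0, a1, a2, t0, t1, t2)"
  have a: "a1 + a0 \<noteq> 0" "a2 + a0 \<noteq> 0" "a1 + a0 + (a2 + a0) \<noteq> 0"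
    using assms(3-) by (simp_all add: algebra_simps)
  have "move_R (move_U ?S) = s1 (s2 (s1 (flip ?S)))"
    by (simp only: move_R_def move_U_def rot_s1 rot_s2 rot_rot_rot)
  also have "\<dots> = s2 (s1 (s2 (flip ?S)))"
    unfolding flip.simps
    by (rule braid) (use solution_flip[OF assms(1,2)] a in \<open>simp_all only: flip.simps not_False_eq_True\<close>)
  also have "\<dots> = move_U (move_R ?S)"
    by (simp only: move_R_def move_U_def rot_s1 rot_s2 rot_flip rot_rot_rot)
  finally show ?thesis .
qed

text \<open>The last \<open>s1\<close> of \<open>move_R\<close> cancels the first \<open>s1\<close>
  of \<open>move_L\<close>; passing the remaining rotation through \<open>s2\<close> turns that
  reflection into \<open>s1\<close>.\<close>

lemma move_L_move_R:
  assumes "solution (a0, a1, a2, t0, t1, t2)" "a0 \<noteq> 0" "a0 + a2 \<noteq> 0"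
  shows "move_L (move_R (a0, a1, a2, t0, t1, t2)) = move_U (a0, a1, a2, t0, t1, t2)"
proof -
  have "a2 + a0 \<noteq> 0" using assms(3) by (simp add: add.commute)
  from s1_s1[OF solution_move_R(1)[OF assms, unfolded rot.simps s2_eq] this]
  have "s1 (s1 (s2 (rot (a0, a1, a2, t0, t1, t2)))) = s2 (rot (a0, a1, a2, t0, t1, t2))"
    by (simp only: rot.simps s2_eq)
  then show ?thesis
    by (simp only: move_L_def move_R_def move_U_def rot_s2)
qed

end

subsection \<open>Polynomial solutions of bilinear equations\<close>

text \<open>A Hirota equation \<open>D_x^2 + A D_x + B\<close> applied to \<open>p\<close> and
  \<open>q\<close>; polynomial coefficients are allowed because removing Gaussian factors changes
  them.\<close>

definition bilinear_pair :: "complex poly \<Rightarrow> complex poly \<Rightarrow> complex poly \<Rightarrow> complex poly \<Rightarrow> bool" where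
  "bilinear_pair A B p q \<longleftrightarrow>
     pderiv (pderiv p) * q - 2 * pderiv p * pderiv q + p * pderiv (pderiv q)
       + A * (pderiv p * q - p * pderiv q) + B * p * q = 0"

lemma bilinear_pair_commute: "bilinear_pair A B p q \<longleftrightarrow> bilinear_pair (- A) B q p"
  by (simp add: bilinear_pair_def algebra_simps)

text \<open>Using \<open>L\<close> times the derivative keeps the power \<open>L ^ k\<close> intact,
  which avoids the exponent \<open>k - 1\<close> and its special case at zero.\<close>

lemma mult_pderiv_power_mult:
  fixes L g :: "complex poly"
  assumes "pderiv L = 1"
  shows "L * pderiv (L ^ k * g) = L ^ k * (of_nat k * g + L * pderiv g)"
proof (induction k)
  case (Suc k)
  have "L * pderiv (L ^ Suc k * g) = L * (L ^ k * g) + L * (L * pderiv (L ^ k * g))"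
    using assms by (simp add: pderiv_mult mult.assoc distrib_left)
  also have "\<dots> = L ^ Suc k * (of_nat (Suc k) * g + L * pderiv g)"
    unfolding Suc.IH by (simp add: algebra_simps)
  finally show ?case .
qed simp

text \<open>Compare the terms of lowest order in the Taylor expansions at \<open>a\<close>.\<close>

lemma bilinear_pair_order:
  assumes "bilinear_pair A B p q" "p \<noteq> 0" "q \<noteq> 0"
  shows "(int (order a p) - int (order a q))\<^sup>2 = int (order a p) + int (order a q)"
proof -
  define k l L where "k = order a p" and "l = order a q" and "L = [:- a, 1:]"
  obtain g where g: "p = L ^ k * g" "\<not> L dvd g"
    using order_decomp[OF assms(2)] by (auto simp: k_def L_def)
  obtain h where h: "q = L ^ l * h" "\<not> L dvd h"
    using order_decomp[OF assms(3)] by (auto simp: l_def L_def)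
  \<comment> \<open>The cofactors of \<open>L ^ k\<close> and \<open>L ^ l\<close> after one
    derivative; \<open>g2\<close> and \<open>h2\<close> below play the same part for second
    derivatives.\<close>
  define g1 h1 where "g1 = of_nat k * g + L * pderiv g" and "h1 = of_nat l * h + L * pderiv h"
  define g2 h2 where "g2 = of_nat k * g1 + L * pderiv g1 - g1" and "h2 = of_nat l * h1 + L * pderiv h1 - h1"
  have L: "poly L a = 0" "pderiv L = 1" "L \<noteq> 0" by (simp_all add: L_def pderiv_pCons)
  have 1: "L * pderiv p = L ^ k * g1" "L * pderiv q = L ^ l * h1"
    using mult_pderiv_power_mult[OF L(2)] by (simp_all only: g h g1_def h1_def)
  have 2: "L * (L * pderiv (pderiv p)) = L ^ k * g2"
  proof -
    have "L * pderiv (L * pderiv p) = L ^ k * (of_nat k * g1 + L * pderiv g1)"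
      unfolding 1 by (rule mult_pderiv_power_mult[OF L(2)])
    moreover have "L * pderiv (L * pderiv p) = L * pderiv p + L * (L * pderiv (pderiv p))"
      by (simp add: pderiv_mult L distrib_left)
    ultimately show ?thesis unfolding g2_def by (metis 1(1) add_diff_cancel_left' right_diff_distrib)
  qed
  have 3: "L * (L * pderiv (pderiv q)) = L ^ l * h2"
  proof -
    have "L * pderiv (L * pderiv q) = L ^ l * (of_nat l * h1 + L * pderiv h1)"
      unfolding 1 by (rule mult_pderiv_power_mult[OF L(2)])
    moreover have "L * pderiv (L * pderiv q) = L * pderiv q + L * (L * pderiv (pderiv q))"
      by (simp add: pderiv_mult L distrib_left)
    ultimately show ?thesis unfolding h2_def by (metis 1(2) add_diff_cancel_left' right_diff_distrib)
  qed
  have bracket: "P * Q * (g2 * h - 2 * g1 * h1 + g * h2 + L * A * (g1 * h - g * h1) + L * L * B * g * h) =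
      L * L * (p2 * (Q * h) - 2 * p1 * q1 + (P * g) * q2 + A * (p1 * (Q * h) - (P * g) * q1) + B * (P * g) * (Q * h))"
    if "L * p1 = P * g1" "L * q1 = Q * h1" "L * (L * p2) = P * g2" "L * (L * q2) = Q * h2" for P Q p1 p2 q1 q2
    using that by algebra
  have "L ^ k * L ^ l * (g2 * h - 2 * g1 * h1 + g * h2 + L * A * (g1 * h - g * h1) + L * L * B * g * h) =
      L * L * (pderiv (pderiv p) * q - 2 * pderiv p * pderiv q + p * pderiv (pderiv q)
       + A * (pderiv p * q - p * pderiv q) + B * p * q)"
    using bracket[OF 1 2 3] unfolding g(1)[symmetric] h(1)[symmetric] .
  also have "\<dots> = 0" using assms(1) by (simp add: bilinear_pair_def)
  finally have "g2 * h - 2 * g1 * h1 + g * h2 + L * A * (g1 * h - g * h1) + L * L * B * g * h = 0"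
    using L(3) by simp
  then have "poly (g2 * h - 2 * g1 * h1 + g * h2 + L * A * (g1 * h - g * h1) + L * L * B * g * h) a = 0"
    by simp
  \<comment> \<open>At \<open>a\<close> all terms carrying \<open>L\<close> vanish, which leaves the
    indicial polynomial \<open>k(k-1) - 2kl + l(l-1)\<close>.\<close>
  then have "poly g a * poly h a *
      (of_nat k * of_nat k - of_nat k - 2 * of_nat k * of_nat l + of_nat l * of_nat l - of_nat l) = 0"
    by (simp add: L g2_def h2_def g1_def h1_def algebra_simps)
  moreover have "poly g a \<noteq> 0" "poly h a \<noteq> 0"
    using g(2) h(2) by (simp_all add: L_def poly_eq_0_iff_dvd)
  ultimately have "of_int (int k * int k - int k - 2 * int k * int l + int l * int l - int l) = (0::complex)"
    by simp
  then have "int k * int k - int k - 2 * int k * int l + int l * int l - int l = 0"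
    by (simp only: of_int_eq_0_iff)
  then show ?thesis
    unfolding k_def[symmetric] l_def[symmetric] by (simp add: power2_eq_square algebra_simps)
qed

text \<open>Subtracting relations gives \<open>u^2 - v^2 = u + v\<close>. Either
  \<open>k = p\<close>, and then \<open>k + p = 0\<close>, or \<open>v = u - 1\<close>, and then
  another difference leaves \<open>u = 0\<close> or \<open>u = 1\<close>.\<close>

lemma pairwise_order_le_1:
  fixes k l p :: int
  assumes "(k - l)\<^sup>2 = k + l" "(k - p)\<^sup>2 = k + p" "(l - p)\<^sup>2 = l + p" "k \<ge> 0" "p \<ge> 0"
  shows "k \<le> 1"
proof -
  define u v where "u = k - l" and "v = l - p"
  have "u\<^sup>2 = k + l" "v\<^sup>2 = l + p" "(u + v)\<^sup>2 = k + p" using assms by (simp_all add: u_def v_def)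
  then have "(u + v) * (u - v - 1) = 0" "(u + v)\<^sup>2 - v\<^sup>2 = u"
    by (simp_all add: u_def v_def power2_eq_square algebra_simps)
  moreover from this(1) have "u + v = 0 \<or> v = u - 1" by auto
  ultimately consider "u + v = 0" | "v = u - 1" "(u + v)\<^sup>2 - v\<^sup>2 = u" by blast
  then show ?thesis
  proof cases
    case 1
    then have "k + p = 0" using \<open>(u + v)\<^sup>2 = k + p\<close> by simp
    then show ?thesis using assms(4,5) by simp
  next
    case 2
    then have "(u + (u - 1))\<^sup>2 - (u - 1)\<^sup>2 = u" by simp
    then have "3 * u * (u - 1) = 0" by (simp add: power2_eq_square algebra_simps)
    then have "u = 0 \<or> u = 1" by simp
    then show ?thesis using 2(1) \<open>u\<^sup>2 = k + l\<close> \<open>v\<^sup>2 = l + p\<close> by (auto simp: u_def v_def)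
  qed
qed

text \<open>A nonconstant common factor of \<open>p\<close> and its derivative would have a complex
  root, and this would be a multiple root of \<open>p\<close>.\<close>

lemma coprime_pderiv_of_order_le_1:
  fixes p :: "complex poly"
  assumes "p \<noteq> 0" "\<And>a. order a p \<le> 1"
  shows "coprime p (pderiv p)"
proof -
  have "rsquarefree p"
    using assms by (auto simp: rsquarefree_def le_Suc_eq)
  then have *: "\<not> (poly p a = 0 \<and> poly (pderiv p) a = 0)" for a
    by (simp add: rsquarefree_roots)
  have "degree (gcd p (pderiv p)) = 0"
  proof (rule ccontr)
    assume "degree (gcd p (pderiv p)) \<noteq> 0"
    then obtain a where "poly (gcd p (pderiv p)) a = 0"
      using alg_closed_imp_poly_has_root[of "gcd p (pderiv p)"] by auto
    then show False
      using * by (metis gcd_dvd1 gcd_dvd2 dvd_trans poly_eq_0_iff_dvd)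
  qed
  then show ?thesis
    using assms(1) by (metis coprime_iff_gcd_eq_1 is_unit_gcd is_unit_iff_degree gcd_eq_0_iff)
qed

lemma bilinear_triple_dvd:
  assumes "bilinear_pair U1 B1 p q" "bilinear_pair U2 B2 p r" "bilinear_pair U3 B3 q r"
    and "p \<noteq> 0" "q \<noteq> 0" "r \<noteq> 0"
  shows "p dvd 2 * (pderiv q * r - q * pderiv r) - (U1 - U2) * q * r"
proof -
  have "order a p \<le> 1" for a
    using pairwise_order_le_1[OF bilinear_pair_order bilinear_pair_order bilinear_pair_order, OF assms(1,4,5,2,4,6,3,5,6), of a]
    by simp
  then have "coprime p (pderiv p)"
    using assms(4) by (intro coprime_pderiv_of_order_le_1)
  moreover have "pderiv p * (2 * (pderiv q * r - q * pderiv r) - (U1 - U2) * q * r) =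
      p * ((pderiv (pderiv q) - U1 * pderiv q + B1 * q) * r - (pderiv (pderiv r) - U2 * pderiv r + B2 * r) * q)"
    using assms(1,2) unfolding bilinear_pair_def by algebra
  ultimately show ?thesis
    by (metis coprime_dvd_mult_right_iff dvd_triv_left)
qed

lemma of_nat_affine_neq_0:
  "3 + 3 * of_nat m + 3 * of_nat n \<noteq> (0 :: complex)" "3 + 3 * of_nat m \<noteq> (0 :: complex)"
proof -
  have "of_nat (3 + 3 * m + 3 * n) \<noteq> (0 :: complex)" "of_nat (3 + 3 * m) \<noteq> (0 :: complex)"
    by (simp_all only: of_nat_eq_0_iff)
  then show "3 + 3 * of_nat m + 3 * of_nat n \<noteq> (0 :: complex)" "3 + 3 * of_nat m \<noteq> (0 :: complex)"
    by simp_all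
qed

text \<open>\<open>E c\<close> stands for \<open>exp (- x\<^sup>4 / 12 + c x\<^sup>2 / 2)\<close>.\<close>

locale gaussian_field = differential_field C D x for C :: "complex \<Rightarrow> 'k::field" and D x +
  fixes emb :: "complex poly \<Rightarrow> 'k" and E :: "complex \<Rightarrow> 'k"
  assumes emb_const: "emb [:c:] = C c" and emb_x: "emb [:0, 1:] = x"
    and emb_add: "emb (p + q) = emb p + emb q" and emb_mult: "emb (p * q) = emb p * emb q"
    and D_emb: "D (emb p) = emb (pderiv p)" and emb_eq_iff [simp]: "emb p = emb q \<longleftrightarrow> p = q"
    and E_neq_0 [simp]: "E c \<noteq> 0" and dlog_E: "dlog (E c) = - (x ^ 3) / 3 + C c * x"
    and E_mult: "a + b = c + d \<Longrightarrow> E a * E b = E c * E d"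
begin

lemma C_uminus: "C (- a) = - C a"
  using C_add[of a "- a"] by (simp add: eq_neg_iff_add_eq_0 add.commute)

lemma C_diff: "C (a - b) = C a - C b"
  using C_add[of a "- b"] by (simp add: C_uminus)

lemma C_eq_iff [simp]: "C a = C b \<longleftrightarrow> a = b"
  by (metis emb_const emb_eq_iff pCons_eq_iff)

lemma C_eq_0_iff [simp]: "C a = 0 \<longleftrightarrow> a = 0"
  using C_eq_iff[of a 0] by simp

lemma C_div_3: "C (a / 3) = C a / 3"
  using C_mult[of "a / 3" 3] by (simp add: field_simps)

lemma C_power2: "C (a\<^sup>2) = (C a)\<^sup>2"
  by (simp add: power2_eq_square C_mult)

lemma emb_0 [simp]: "emb 0 = 0" and emb_1 [simp]: "emb 1 = 1"
  using emb_const[of 0] emb_const[of 1] by (simp_all add: one_pCons)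

lemma emb_2 [simp]: "emb 2 = 2"
  using emb_add[of 1 1] by simp

lemma emb_eq_0_iff [simp]: "emb p = 0 \<longleftrightarrow> p = 0"
  using emb_eq_iff[of p 0] by simp

lemma emb_uminus: "emb (- p) = - emb p"
  using emb_add[of p "- p"] by (simp add: eq_neg_iff_add_eq_0 add.commute)

lemma emb_diff: "emb (p - q) = emb p - emb q"
  using emb_add[of p "- q"] by (simp add: emb_uminus)

lemma emb_pCons: "emb (pCons c p) = C c + x * emb p"
proof -
  have "pCons c p = [:c:] + [:0, 1:] * p" by simp
  then show ?thesis by (metis emb_add emb_mult emb_const emb_x)
qed

section \<open>Reflections preserve Gaussians times polynomials\<close>

lemma dlog_E_mult: "dlog (E c * emb h) = - (x ^ 3) / 3 + C c * x + emb (pderiv h) / emb h" if "h \<noteq> 0"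
  using that by (simp add: dlog_mult dlog_E) (simp add: dlog_def D_emb)

lemma D_x3: "D (x ^ 3) = 3 * x\<^sup>2"
  by (simp add: power3_eq_cube D_mult power2_eq_square algebra_simps)

lemma D_dlog_E_mult:
  assumes "h \<noteq> 0"
  shows "D (dlog (E c * emb h)) =
    - x\<^sup>2 + C c + (emb (pderiv (pderiv h)) * emb h - (emb (pderiv h))\<^sup>2) / (emb h)\<^sup>2"
proof -
  have "D (- (x ^ 3) / 3) = - x\<^sup>2"
    by (simp add: D_divide D_uminus D_x3 field_simps)
  moreover have "D (C c * x) = C c" by (simp add: D_mult)
  moreover have "D (emb (pderiv h) / emb h) =
      (emb (pderiv (pderiv h)) * emb h - (emb (pderiv h))\<^sup>2) / (emb h)\<^sup>2"
    using assms by (simp add: D_divide D_emb power2_eq_square)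
  ultimately show ?thesis
    by (simp only: dlog_E_mult[OF assms] D_add)
qed

text \<open>Adding two logarithmic equations eliminates the third tau function and recovers a
  bilinear equation; conjugation by the Gaussians adds \<open>2 (c0 - c1) x\<close> to its
  first-order coefficient.\<close>

lemma solution_bilinear_pair:
  assumes "solution (C \<alpha>0, C \<alpha>1, C \<alpha>2, E c0 * emb h0, E c1 * emb h1, E c2 * emb h2)"
  shows "\<exists>B. bilinear_pair [:0, 2 * (c0 - c1) - 1:] B h0 h1"
proof -
  \<comment> \<open>The \<open>x^2\<close> coefficient collects \<open>-2\<close> from the two
    quartic exponents, \<open>(c0 - c1)^2\<close> from the square and \<open>-(c0 - c1)\<close> from
    the term \<open>- x (u0 - u1)\<close>.\<close>
  define B where "B = [:c0 + c1 - (\<alpha>0 - \<alpha>1) / 3, 0, (c0 - c1)\<^sup>2 - (c0 - c1) - 2:]"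
  have nz: "h0 \<noteq> 0" "h1 \<noteq> 0" "h2 \<noteq> 0" using assms by auto
  define u0 where "u0 = dlog (E c0 * emb h0)"
  define u1 where "u1 = dlog (E c1 * emb h1)"
  define u2 where "u2 = dlog (E c2 * emb h2)"
  have "D u0 + D u1 = x * (u0 - u1) - (u0 - u1)\<^sup>2 + (C \<alpha>0 - C \<alpha>1) / 3"
    using assms by (simp add: u0_def[symmetric] u1_def[symmetric] u2_def[symmetric])
      (simp add: painleve4_def power2_eq_square field_simps)
  then have *: "(D u0 + D u1 - x * (u0 - u1) + (u0 - u1)\<^sup>2 - (C \<alpha>0 - C \<alpha>1) / 3) * emb h0 * emb h1 = 0"
    by simp
  define w0 where "w0 = emb (pderiv h0) / emb h0"
  define w1 where "w1 = emb (pderiv h1) / emb h1"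
  have w: "emb (pderiv h0) = w0 * emb h0" "emb (pderiv h1) = w1 * emb h1"
    using nz by (simp_all add: w0_def w1_def)
  define v0 where "v0 = emb (pderiv (pderiv h0)) / emb h0"
  define v1 where "v1 = emb (pderiv (pderiv h1)) / emb h1"
  have v: "emb (pderiv (pderiv h0)) = v0 * emb h0" "emb (pderiv (pderiv h1)) = v1 * emb h1"
    using nz by (simp_all add: v0_def v1_def)
  have u: "u0 - u1 = C (c0 - c1) * x + w0 - w1"
    using nz by (simp add: u0_def u1_def dlog_E_mult w0_def w1_def C_diff algebra_simps)
  have Du: "D u0 = - x\<^sup>2 + C c0 + v0 - w0\<^sup>2" "D u1 = - x\<^sup>2 + C c1 + v1 - w1\<^sup>2"
    using nz by (simp_all add: u0_def u1_def D_dlog_E_mult w v power2_eq_square diff_divide_distrib)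
  have "emb (pderiv (pderiv h0) * h1 - 2 * pderiv h0 * pderiv h1 + h0 * pderiv (pderiv h1)
       + [:0, 2 * (c0 - c1) - 1:] * (pderiv h0 * h1 - h0 * pderiv h1) + B * h0 * h1) =
    (v0 - 2 * w0 * w1 + v1 + x * (2 * C (c0 - c1) - 1) * (w0 - w1) +
      (C c0 + C c1 - (C \<alpha>0 - C \<alpha>1) / 3 + x\<^sup>2 * ((C (c0 - c1))\<^sup>2 - C (c0 - c1) - 2))) * emb h0 * emb h1"
    unfolding B_def
    by (simp only: emb_add emb_diff emb_mult emb_pCons w v C_add C_diff C_mult C_numeral C_div_3 C_power2 emb_2
        C_0 C_1 emb_0)
       (simp add: algebra_simps power2_eq_square)
  also have "\<dots> = (D u0 + D u1 - x * (u0 - u1) + (u0 - u1)\<^sup>2 - (C \<alpha>0 - C \<alpha>1) / 3) * emb h0 * emb h1"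
    unfolding Du u by (simp add: algebra_simps power2_eq_square)
  finally have "bilinear_pair [:0, 2 * (c0 - c1) - 1:] B h0 h1"
    unfolding bilinear_pair_def * by simp
  then show ?thesis ..
qed

text \<open>\<open>W\<close> is the numerator of the reflected tau function stripped of its
  Gaussians. The first-order coefficients of the two equations containing \<open>h0\<close> differ
  by \<open>-2 (1 + c1 - c2) x\<close>, so \<open>bilinear_triple_dvd\<close> says exactly that
  \<open>h0\<close> divides \<open>2 W\<close>.\<close>

lemma solution_flip_poly:
  assumes sol: "solution (C \<alpha>0, C \<alpha>1, C \<alpha>2, E c0 * emb h0, E c1 * emb h1, E c2 * emb h2)"
  shows "\<exists>h. flip (C \<alpha>0, C \<alpha>1, C \<alpha>2, E c0 * emb h0, E c1 * emb h1, E c2 * emb h2) =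
    (C (- \<alpha>0), C (\<alpha>1 + \<alpha>0), C (\<alpha>2 + \<alpha>0), E (c1 + c2 - c0) * emb h, E c1 * emb h1, E c2 * emb h2)"
proof -
  let ?S = "(C \<alpha>0, C \<alpha>1, C \<alpha>2, E c0 * emb h0, E c1 * emb h1, E c2 * emb h2)"
  have nz: "h0 \<noteq> 0" "h1 \<noteq> 0" "h2 \<noteq> 0" using sol by simp_all
  have "solution (rot ?S)" "solution (rot (rot ?S))" using sol by (simp_all only: solution_rot)
  note rsol = this[unfolded rot.simps]
  obtain B1 where B1: "bilinear_pair [:0, 2 * (c0 - c1) - 1:] B1 h0 h1"
    using solution_bilinear_pair[OF sol] by blast
  obtain B2 where "bilinear_pair [:0, 2 * (c2 - c0) - 1:] B2 h2 h0"
    using solution_bilinear_pair[OF rsol(2)] by blast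
  then have B2: "bilinear_pair (- [:0, 2 * (c2 - c0) - 1:]) B2 h0 h2"
    by (rule bilinear_pair_commute[THEN iffD1])
  obtain B3 where B3: "bilinear_pair [:0, 2 * (c1 - c2) - 1:] B3 h1 h2"
    using solution_bilinear_pair[OF rsol(1)] by blast
  define W where "W = pderiv h1 * h2 - h1 * pderiv h2 + [:0, 1 + c1 - c2:] * h1 * h2"
  have "h0 dvd smult 2 W"
  proof -
    have eq: "[:0, 2 * (c0 - c1) - 1:] - (- [:0, 2 * (c2 - c0) - 1:]) = - smult 2 [:0, 1 + c1 - c2:]"
      by (simp add: algebra_simps)
    have "2 * (pderiv h1 * h2 - h1 * pderiv h2) -
        ([:0, 2 * (c0 - c1) - 1:] - (- [:0, 2 * (c2 - c0) - 1:])) * h1 * h2 =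
        2 * (pderiv h1 * h2 - h1 * pderiv h2) + smult 2 [:0, 1 + c1 - c2:] * h1 * h2"
      unfolding eq by (simp only: mult_minus_left diff_minus_eq_add)
    also have "\<dots> = smult 2 W"
    proof -
      have "2 * (pderiv h1 * h2 - h1 * pderiv h2) = smult 2 (pderiv h1 * h2 - h1 * pderiv h2)"
        by (simp add: numeral_poly)
      then show ?thesis by (simp only: W_def smult_add_right mult_smult_left)
    qed
    finally have W2: "2 * (pderiv h1 * h2 - h1 * pderiv h2) -
        ([:0, 2 * (c0 - c1) - 1:] - (- [:0, 2 * (c2 - c0) - 1:])) * h1 * h2 = smult 2 W" .
    show ?thesis
      unfolding W2[symmetric] by (rule bilinear_triple_dvd[OF B1 B2 B3 nz])
  qed
  then have "h0 dvd W" by (simp add: dvd_smult_iff)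
  then obtain h where h: "W = h0 * h" by blast
  define w1 where "w1 = emb (pderiv h1) / emb h1"
  define w2 where "w2 = emb (pderiv h2) / emb h2"
  have w: "emb (pderiv h1) = w1 * emb h1" "emb (pderiv h2) = w2 * emb h2"
    using nz by (simp_all add: w1_def w2_def)
  have "emb W = (x + (C c1 * x + w1) - (C c2 * x + w2)) * (emb h1 * emb h2)"
    unfolding W_def emb_add emb_diff emb_mult emb_pCons w C_add C_diff by (simp add: algebra_simps)
  then have f: "x + dlog (E c1 * emb h1) - dlog (E c2 * emb h2) = emb W / (emb h1 * emb h2)"
    using nz by (simp add: dlog_E_mult w1_def w2_def)
  have "E c1 * E c2 = E (c1 + c2 - c0) * E c0"
    by (rule E_mult) simp
  then have e1: "E c1 * E c2 / E c0 = E (c1 + c2 - c0)" by (simp add: field_simps)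
  have e2: "emb W / (emb h1 * emb h2) * (E c1 * emb h1) * (E c2 * emb h2) / (E c0 * emb h0) =
      (E c1 * E c2 / E c0) * (emb W / emb h0)"
    using nz by simp
  have e3: "emb W / emb h0 = emb h" using nz by (simp add: h emb_mult)
  have "flip ?S = (C (- \<alpha>0), C (\<alpha>1 + \<alpha>0), C (\<alpha>2 + \<alpha>0), E (c1 + c2 - c0) * emb h, E c1 * emb h1, E c2 * emb h2)"
    unfolding flip.simps f e2 e3 e1 C_uminus C_add ..
  then show ?thesis ..
qed

text \<open>The Gaussian rates are tracked explicitly since they follow a linear rule; parameters
  and polynomials are only asserted to exist.\<close>

definition poly_state :: "complex \<Rightarrow> complex \<Rightarrow> complex \<Rightarrow> 'k state \<Rightarrow> bool" where
  "poly_state c0 c1 c2 S \<longleftrightarrow> (\<exists>\<alpha>0 \<alpha>1 \<alpha>2 h0 h1 h2.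
     S = (C \<alpha>0, C \<alpha>1, C \<alpha>2, E c0 * emb h0, E c1 * emb h1, E c2 * emb h2))"

lemma poly_state_rot: "poly_state c0 c1 c2 S \<Longrightarrow> poly_state c1 c2 c0 (rot S)"
  unfolding poly_state_def by (elim exE) (simp only: rot.simps, blast)

lemma poly_state_flip:
  assumes "poly_state c0 c1 c2 S" "solution S"
  shows "poly_state (c1 + c2 - c0) c1 c2 (flip S)"
proof -
  obtain \<alpha>0 \<alpha>1 \<alpha>2 h0 h1 h2 where
    S: "S = (C \<alpha>0, C \<alpha>1, C \<alpha>2, E c0 * emb h0, E c1 * emb h1, E c2 * emb h2)"
    using assms(1) unfolding poly_state_def by blast
  show ?thesis
    using solution_flip_poly[OF assms(2)[unfolded S]] unfolding S poly_state_def by blast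
qed

lemma poly_state_s1:
  assumes "poly_state c0 c1 c2 S" "solution S"
  shows "poly_state c0 (c2 + c0 - c1) c2 (s1 S)"
  unfolding s1_def
  by (intro poly_state_rot[of _ c0] poly_state_rot poly_state_flip[of c1 c2 c0] assms) (simp add: solution_rot assms)

lemma poly_state_s2:
  assumes "poly_state c0 c1 c2 S" "solution S"
  shows "poly_state c0 c1 (c0 + c1 - c2) (s2 S)"
  unfolding s2_def
  by (intro poly_state_rot poly_state_flip[of c2 c0 c1] assms) (simp add: solution_rot assms)

subsection \<open>The orbit of the seed\<close>

definition seed_state :: "'k state" where
  "seed_state = (C 3, C 0, C 0, E 0, E 1, E (- 1))"

lemma D_dlog_E: "D (dlog (E c)) = - x\<^sup>2 + C c"
  using D_dlog_E_mult[of 1 c] by simp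

lemma solution_seed: "solution seed_state"
proof -
  have "C (- 1) = - 1" using C_uminus[of 1] by simp
  then show ?thesis
    by (simp add: seed_state_def painleve4_def D_dlog_E) (simp add: dlog_E field_simps power2_eq_square)
qed

text \<open>The point \<open>(M, N)\<close> carries \<open>\<tau>\<^sub>m\<^sub>,\<^sub>n\<close> for \<open>m = M + N\<close>, \<open>n = N\<close>.\<close>

definition lattice_state :: "nat \<Rightarrow> nat \<Rightarrow> 'k state" where
  "lattice_state M N = (move_R ^^ M) ((move_U ^^ N) seed_state)"

text \<open>The invariant carried along the moves. Explicit parameters allow nonvanishing to be
  checked, and the rate \<open>M - N\<close> is \<open>m - 2n\<close> in the original
  indices.\<close>

definition at_lattice_point :: "nat \<Rightarrow> nat \<Rightarrow> 'k state \<Rightarrow> bool" where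
  "at_lattice_point M N S \<longleftrightarrow> solution S \<and>
     poly_state (of_nat M - of_nat N) (of_nat M - of_nat N + 1) (of_nat M - of_nat N - 1) S \<and>
     (\<exists>t0 t1 t2. S = (C (3 + 3 * of_nat M + 3 * of_nat N), C (- 3 * of_nat M), C (- 3 * of_nat N), t0, t1, t2))"

text \<open>The four values are \<open>3(1+M+N)\<close>, \<open>3(1+N)\<close>,
  \<open>3(1+M)\<close> and \<open>3(2+M+N)\<close>: the nonvanishing conditions of the moves and of
  their commutation.\<close>

lemma lattice_parameters_neq_0:
  defines "a0 \<equiv> \<lambda>M N. C (3 + 3 * of_nat M + 3 * of_nat N)"
    and "a1 \<equiv> \<lambda>M. C (- 3 * of_nat M)" and "a2 \<equiv> \<lambda>N. C (- 3 * of_nat N)"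
  shows "a0 M N \<noteq> 0" "a0 M N + a1 M \<noteq> 0" "a0 M N + a2 N \<noteq> 0" "2 * a0 M N + a1 M + a2 N \<noteq> 0"
proof -
  have "2 * a0 M N = C (2 * (3 + 3 * of_nat M + 3 * of_nat N))" by (simp only: a0_def C_mult C_numeral)
  then have "2 * a0 M N + a1 M + a2 N = C (3 + (3 + 3 * of_nat M + 3 * of_nat N))"
    by (simp only: a1_def a2_def C_add[symmetric] C_eq_iff) simp
  moreover have "3 + (3 + 3 * of_nat M + 3 * of_nat N) = (3 + 3 * of_nat (Suc M) + 3 * of_nat N :: complex)" by simp
  ultimately show "2 * a0 M N + a1 M + a2 N \<noteq> 0" using of_nat_affine_neq_0(1)[of "Suc M" N] by simp
  show "a0 M N \<noteq> 0" unfolding a0_def C_eq_0_iff by (rule of_nat_affine_neq_0)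
  show "a0 M N + a1 M \<noteq> 0" "a0 M N + a2 N \<noteq> 0"
    using of_nat_affine_neq_0(2) by (simp_all add: a0_def a1_def a2_def C_add[symmetric])
qed

lemma at_lattice_point_move_R:
  assumes "at_lattice_point M N S"
  shows "at_lattice_point (Suc M) N (move_R S)" "solution (s2 (rot S))"
proof -
  note nz = lattice_parameters_neq_0[of M N]
  let ?c = "of_nat M - of_nat N :: complex"
  from assms obtain t0 t1 t2
    where S: "S = (C (3 + 3 * of_nat M + 3 * of_nat N), C (- 3 * of_nat M), C (- 3 * of_nat N), t0, t1, t2)"
      and sol: "solution S" and ps: "poly_state ?c (?c + 1) (?c - 1) S"
    unfolding at_lattice_point_def by blast
  note eq = move_R_eq[OF sol[unfolded S] nz(1), folded S]
  note sol' = solution_move_R[OF sol[unfolded S] nz(1,3), folded S]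
  show "solution (s2 (rot S))" by (rule sol')
  have "poly_state (?c + 1) (?c - 1) ?c (rot S)" using ps by (rule poly_state_rot)
  note ps' = poly_state_s1[OF poly_state_s2[OF this sol[folded solution_rot[of S]]] sol'(1), folded move_R_def]
  have "?c + 1 + (?c - 1) - ?c = ?c" "?c + (?c + 1) - (?c - 1) = ?c + 2" by simp_all
  then have ps'': "poly_state (?c + 1) (?c + 2) ?c (move_R S)" using ps' by (simp only:)
  have e1: "C (- 3 * of_nat M) + C (- 3 * of_nat N) + 2 * C (3 + 3 * of_nat M + 3 * of_nat N) =
      C (3 + 3 * of_nat (Suc M) + 3 * of_nat N)"
    unfolding C_numeral[of "num.Bit0 num.One", symmetric] C_mult[symmetric] C_add[symmetric] C_eq_iff by simp
  have e2: "- C (- 3 * of_nat N) - C (3 + 3 * of_nat M + 3 * of_nat N) = C (- 3 * of_nat (Suc M))"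
    unfolding C_uminus[symmetric] C_diff[symmetric] C_eq_iff by simp
  have c: "of_nat (Suc M) - of_nat N = ?c + 1" "?c + 1 + 1 = ?c + 2" "?c + 1 - 1 = ?c" by simp_all
  show "at_lattice_point (Suc M) N (move_R S)"
    unfolding at_lattice_point_def c using sol'(2) ps'' eq[unfolded e1 e2] by blast
qed

lemma at_lattice_point_move_U:
  assumes "at_lattice_point M N S"
  shows "at_lattice_point M (Suc N) (move_U S)"
proof -
  note nz = lattice_parameters_neq_0[of M N]
  let ?c = "of_nat M - of_nat N :: complex"
  from assms obtain t0 t1 t2
    where S: "S = (C (3 + 3 * of_nat M + 3 * of_nat N), C (- 3 * of_nat M), C (- 3 * of_nat N), t0, t1, t2)"
      and sol: "solution S" and ps: "poly_state ?c (?c + 1) (?c - 1) S"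
    unfolding at_lattice_point_def by blast
  note eq = move_U_eq[OF sol[unfolded S] nz(1), folded S]
  note sol' = solution_move_U[OF sol[unfolded S] nz(1,2), folded S]
  have rsol: "solution (rot (rot S))" using sol by (simp only: solution_rot)
  then have "solution (s1 (rot (rot S)))"
    unfolding S rot.simps using nz(1) by (rule solution_s1)
  moreover have "poly_state (?c - 1) ?c (?c + 1) (rot (rot S))" using ps by (intro poly_state_rot)
  ultimately have ps': "poly_state (?c - 1) (?c + 1 + (?c - 1) - ?c)
      (?c - 1 + (?c + 1 + (?c - 1) - ?c) - (?c + 1)) (move_U S)"
    unfolding move_U_def using rsol by (intro poly_state_s2 poly_state_s1)
  have "?c + 1 + (?c - 1) - ?c = ?c" "?c - 1 + ?c - (?c + 1) = ?c - 2" by simp_all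
  then have ps'': "poly_state (?c - 1) ?c (?c - 2) (move_U S)" using ps' by (simp only:)
  have e1: "C (- 3 * of_nat N) + 2 * C (3 + 3 * of_nat M + 3 * of_nat N) + C (- 3 * of_nat M) =
      C (3 + 3 * of_nat M + 3 * of_nat (Suc N))"
    unfolding C_numeral[of "num.Bit0 num.One", symmetric] C_mult[symmetric] C_add[symmetric] C_eq_iff by simp
  have e2: "- C (3 + 3 * of_nat M + 3 * of_nat N) - C (- 3 * of_nat M) = C (- 3 * of_nat (Suc N))"
    unfolding C_uminus[symmetric] C_diff[symmetric] C_eq_iff by simp
  have c: "of_nat M - of_nat (Suc N) = ?c - 1" "?c - 1 + 1 = ?c" "?c - 1 - 1 = ?c - 2" by simp_all
  show ?thesis
    unfolding at_lattice_point_def c using sol' ps'' eq[unfolded e1 e2] by blast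
qed

lemma at_lattice_point_seed: "at_lattice_point 0 0 seed_state"
proof -
  have "poly_state 0 1 (- 1) seed_state"
    unfolding poly_state_def seed_state_def by (metis emb_1 mult.right_neutral)
  then show ?thesis
    using solution_seed by (simp add: at_lattice_point_def) (simp add: seed_state_def)
qed

lemma at_lattice_point_lattice_state: "at_lattice_point M N (lattice_state M N)"
proof -
  have "at_lattice_point 0 N ((move_U ^^ N) seed_state)"
    by (induction N) (auto intro: at_lattice_point_seed at_lattice_point_move_U)
  then show ?thesis
    unfolding lattice_state_def by (induction M) (auto intro: at_lattice_point_move_R)
qed

section \<open>The lattice of states and its tau functions\<close>

lemma lattice_state_Suc_left: "lattice_state (Suc M) N = move_R (lattice_state M N)"
  by (simp add: lattice_state_def)

text \<open>All upward moves come first in \<open>lattice_state\<close>, so a further one has to be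
  commuted past the \<open>M\<close> moves to the right.\<close>

lemma lattice_state_Suc_right: "lattice_state M (Suc N) = move_U (lattice_state M N)"
proof (induction M)
  case (Suc M)
  obtain t0 t1 t2 where
    S: "lattice_state M N = (C (3 + 3 * of_nat M + 3 * of_nat N), C (- 3 * of_nat M), C (- 3 * of_nat N), t0, t1, t2)"
    and sol: "solution (lattice_state M N)"
    using at_lattice_point_lattice_state[of M N] unfolding at_lattice_point_def by blast
  show ?case
    using move_R_move_U[OF sol[unfolded S] lattice_parameters_neq_0[of M N]]
    by (simp only: lattice_state_Suc_left Suc.IH S)
qed (simp add: lattice_state_def)

lemma move_L_lattice_state: "move_L (lattice_state (Suc M) N) = lattice_state M (Suc N)"
proof -
  obtain t0 t1 t2 where
    S: "lattice_state M N = (C (3 + 3 * of_nat M + 3 * of_nat N), C (- 3 * of_nat M), C (- 3 * of_nat N), t0, t1, t2)"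
    and sol: "solution (lattice_state M N)"
    using at_lattice_point_lattice_state[of M N] unfolding at_lattice_point_def by blast
  show ?thesis
    using move_L_move_R[OF sol[unfolded S] lattice_parameters_neq_0(1,3)[of M N]]
    by (simp only: lattice_state_Suc_left lattice_state_Suc_right S)
qed

fun state_tau0 :: "'k state \<Rightarrow> 'k" where "state_tau0 (a0, a1, a2, t0, t1, t2) = t0"

definition lattice_tau :: "nat \<Rightarrow> nat \<Rightarrow> 'k" where "lattice_tau M N = state_tau0 (lattice_state M N)"

text \<open>A move to the right brings \<open>t1\<close> into the leading position and an upward
  move brings \<open>t2\<close> there, so these are the tau functions of the neighbouring
  points.\<close>

lemma lattice_state_eq:
  "lattice_state M N = (C (3 + 3 * of_nat M + 3 * of_nat N), C (- 3 * of_nat M), C (- 3 * of_nat N),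
     lattice_tau M N, lattice_tau (Suc M) N, lattice_tau M (Suc N))"
proof -
  obtain t0 t1 t2 where
    S: "lattice_state M N = (C (3 + 3 * of_nat M + 3 * of_nat N), C (- 3 * of_nat M), C (- 3 * of_nat N), t0, t1, t2)"
    and sol: "solution (lattice_state M N)"
    using at_lattice_point_lattice_state[of M N] unfolding at_lattice_point_def by blast
  note nz = lattice_parameters_neq_0[of M N]
  show ?thesis
    using move_R_eq[OF sol[unfolded S] nz(1)] move_U_eq[OF sol[unfolded S] nz(1)]
    by (simp add: lattice_tau_def lattice_state_Suc_left lattice_state_Suc_right S del: minus_mult_left mult_minus_left)
qed

lemma solution_lattice_state: "solution (lattice_state M N)"
  using at_lattice_point_lattice_state unfolding at_lattice_point_def by blast

section \<open>Evaluation of the translation words\<close>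

lemma has_value_Tr1:
  assumes "has_value (point (lattice_state (Suc M) N)) q y"
  shows "has_value (point (lattice_state M N)) (Tr1 q) y"
proof -
  have "solution (s2 (rot (lattice_state M N)))"
    by (rule at_lattice_point_move_R[OF at_lattice_point_lattice_state])
  then have "has_value (point (s2 (rot (lattice_state M N)))) (sA 1 q) y"
    by (rule has_value_sA_1) (use assms in \<open>simp only: lattice_state_Suc_left move_R_def\<close>)
  \<comment> \<open>Contravariance: the outermost automorphism \<open>piA\<close> acts first on the
    state, giving \<open>rot\<close>, then \<open>s2\<close>, then \<open>s1\<close>.\<close>
  then show ?thesis
    unfolding Tr1_def comp_def using solution_lattice_state
    by (intro has_value_piA has_value_sA_2) (simp_all only: solution_rot)
qed

text \<open>The first reflection has parameter \<open>-3 (M + 1)\<close>. On the boundary column its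
  parameter would be zero, which is where the restriction to \<open>n \<le> m\<close>
  enters.\<close>

lemma has_value_Tr2:
  assumes "has_value (point (lattice_state M (Suc N))) q y"
  shows "has_value (point (lattice_state (Suc M) N)) (Tr2 q) y"
proof -
  have "C (- 3 * of_nat (Suc M)) \<noteq> 0" unfolding C_eq_0_iff mult_eq_0_iff of_nat_eq_0_iff by simp
  with solution_lattice_state[of "Suc M" N] have "solution (s1 (lattice_state (Suc M) N))"
    unfolding lattice_state_eq[of "Suc M" N] by (rule solution_s1)
  moreover have "has_value (point (s2 (rot (s1 (lattice_state (Suc M) N))))) q y"
    using assms by (simp only: move_L_lattice_state[symmetric] move_L_def)
  ultimately show ?thesis
    unfolding Tr2_def comp_def using solution_lattice_state
    by (intro has_value_sA_1 has_value_piA has_value_sA_2) (simp_all only: solution_rot)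
qed

text \<open>The outer power of \<open>Tr1\<close> carries the seed from \<open>(0, 0)\<close> to
  \<open>(m, 0)\<close>; each \<open>Tr2\<close> then lowers the first index and raises the second,
  ending at \<open>(m - n, n)\<close>.\<close>

lemma has_value_tau_mn:
  assumes "n \<le> m"
  shows "has_value (point seed_state) (tau_mn m n) (lattice_tau (m - n) n)"
proof -
  have Tr2: "has_value (point (lattice_state M N)) ((Tr2 ^^ n) (tau 0)) (lattice_tau (M - n) (N + n))"
    if "n \<le> M" for M N
    using that
  proof (induction n arbitrary: M N)
    case 0
    then show ?case using has_value_tau(1) by (simp add: lattice_state_eq del: point.simps)
  next
    case (Suc n)
    then obtain M' where M': "M = Suc M'" by (cases M) auto
    show ?case
      using has_value_Tr2[OF Suc.IH[of M' "Suc N"]] Suc.prems by (simp add: M')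
  qed
  have "has_value (point (lattice_state m 0)) ((Tr2 ^^ n) (tau 0)) (lattice_tau (m - n) n)"
    using Tr2[of m 0] assms by simp
  moreover have "has_value (point (lattice_state M 0)) ((Tr1 ^^ k) q) y"
    if "has_value (point (lattice_state (M + k) 0)) q y" for M k q y
    using that
  proof (induction k arbitrary: M)
    case (Suc k)
    then show ?case using has_value_Tr1[OF Suc.IH[of "Suc M"]] by simp
  qed simp
  ultimately have "has_value (point (lattice_state 0 0)) (tau_mn m n) (lattice_tau (m - n) n)"
    by (simp add: tau_mn_def)
  then show ?thesis by (simp add: lattice_state_def)
qed

section \<open>Toda equations and initial values\<close>

lemma solution_f_product:
  assumes "solution (a0, a1, a2, t0, t1, t2)"
  shows "(x + dlog t0 - dlog t1) * (x + dlog t1 - dlog t2) = D (dlog t1) + x\<^sup>2 + (a2 - a0) / 3"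
    and "(x + dlog t1 - dlog t2) * (x + dlog t2 - dlog t0) = D (dlog t2) + x\<^sup>2 + (a0 - a1) / 3"
proof -
  have "D (dlog t1) = painleve4 a2 a0 (dlog t1) (dlog t2) (dlog t0)"
    "D (dlog t2) = painleve4 a0 a1 (dlog t2) (dlog t0) (dlog t1)" using assms by simp_all
  \<comment> \<open>Up to \<open>x^2\<close> and a constant the right-hand side for
    \<open>F_i''\<close> factors; this is how a second logarithmic derivative enters the Toda
    equation.\<close>
  then show "(x + dlog t0 - dlog t1) * (x + dlog t1 - dlog t2) = D (dlog t1) + x\<^sup>2 + (a2 - a0) / 3"
    and "(x + dlog t1 - dlog t2) * (x + dlog t2 - dlog t0) = D (dlog t2) + x\<^sup>2 + (a0 - a1) / 3"
    by (simp_all only: painleve4_def) (simp_all add: field_simps power2_eq_square)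
qed

lemma lattice_tau_neq_0: "lattice_tau M N \<noteq> 0"
  using solution_lattice_state[of M N] unfolding lattice_state_eq by simp

text \<open>The choice is determined, as \<open>E\<close> is nonzero and \<open>emb\<close> is
  injective.\<close>

definition hermite :: "nat \<Rightarrow> nat \<Rightarrow> complex poly" where
  "hermite M N = (SOME h. lattice_tau M N = E (of_nat M - of_nat N) * emb h)"

lemma lattice_tau_hermite: "lattice_tau M N = E (of_nat M - of_nat N) * emb (hermite M N)"
proof -
  have "\<exists>h. lattice_tau M N = E (of_nat M - of_nat N) * emb h"
    using at_lattice_point_lattice_state[of M N]
    unfolding at_lattice_point_def poly_state_def lattice_state_eq by blast
  then show ?thesis unfolding hermite_def by (rule someI_ex)
qed

lemma hermite_neq_0 [simp]: "hermite M N \<noteq> 0"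
  using lattice_tau_neq_0[of M N] by (auto simp: lattice_tau_hermite)

lemma hermite_eqI: "lattice_tau M N = E (of_nat M - of_nat N) * emb h \<Longrightarrow> hermite M N = h"
  by (simp add: lattice_tau_hermite)

text \<open>Equal sums of rates let the Gaussians cancel. The \<open>- x^2\<close> from the quartic
  exponent removes \<open>x^2\<close>, and the rate \<open>c\<close> joins \<open>k\<close> in the
  final constant \<open>e\<close>.\<close>

lemma toda_cancel:
  assumes "w1 = E c1 * emb h1" "w = E c * emb h" "w2 = E c2 * emb h2" "h \<noteq> 0" "c1 + c2 = c + c"
    and "w1 * w2 = (D (dlog w) + x\<^sup>2 + C k) * w\<^sup>2" "c + k = e"
  shows "h * pderiv (pderiv h) - (pderiv h)\<^sup>2 + [:e:] * h\<^sup>2 = h1 * h2"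
proof -
  have e: "C c + C k = C e" using assms(7) by (simp add: C_add[symmetric])
  have "D (dlog w) + x\<^sup>2 + C k =
      C e + (emb (pderiv (pderiv h)) * emb h - (emb (pderiv h))\<^sup>2) / (emb h)\<^sup>2"
    unfolding assms(2) D_dlog_E_mult[OF assms(4)] e[symmetric] by (simp add: algebra_simps)
  moreover have "emb (h * pderiv (pderiv h) - (pderiv h)\<^sup>2 + [:e:] * h\<^sup>2) =
      emb h * emb (pderiv (pderiv h)) - (emb (pderiv h))\<^sup>2 + C e * (emb h)\<^sup>2"
    by (simp only: emb_add emb_diff emb_mult emb_const power2_eq_square)
  ultimately have "w1 * w2 = (E c * E c) * emb (h * pderiv (pderiv h) - (pderiv h)\<^sup>2 + [:e:] * h\<^sup>2)"
    using assms(4)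
    by (simp only: assms(6)) (simp add: assms(2) power2_eq_square field_simps)
  moreover have "w1 * w2 = (E c1 * E c2) * emb (h1 * h2)"
    by (simp add: assms(1,3) emb_mult)
  ultimately have "(E c * E c) * emb (h1 * h2) =
      (E c * E c) * emb (h * pderiv (pderiv h) - (pderiv h)\<^sup>2 + [:e:] * h\<^sup>2)"
    using E_mult[OF assms(5)] by simp
  then show ?thesis by (simp add: emb_eq_iff del: mult_pCons_left)
qed

text \<open>Two steps to the right give \<open>f_2 f_0 + a0\<close>. The constant
  \<open>(a2 - a0)/3 + a0 = 2 + 2M + N\<close> plus the rate \<open>M + 1 - N\<close> is
  \<open>3(M + 1)\<close>.\<close>

lemma hermite_toda_left:
  "hermite (Suc M) N * pderiv (pderiv (hermite (Suc M) N)) - (pderiv (hermite (Suc M) N))\<^sup>2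
     + of_nat (3 * Suc M) * (hermite (Suc M) N)\<^sup>2 = hermite (Suc (Suc M)) N * hermite M N"
proof -
  let ?a0 = "3 + 3 * of_nat M + 3 * of_nat N :: complex" and ?a2 = "- 3 * of_nat N :: complex"
  note sol = solution_lattice_state[of M N, unfolded lattice_state_eq]
  have "lattice_tau (Suc (Suc M)) N =
      ((x + dlog (lattice_tau M N) - dlog (lattice_tau (Suc M) N)) *
        (x + dlog (lattice_tau (Suc M) N) - dlog (lattice_tau M (Suc N))) + C ?a0) *
        (lattice_tau (Suc M) N)\<^sup>2 / lattice_tau M N"
    using move_R_eq[OF sol lattice_parameters_neq_0(1)] lattice_state_Suc_left[of M N]
    unfolding lattice_state_eq by simp
  then have "lattice_tau (Suc (Suc M)) N * lattice_tau M N =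
      (D (dlog (lattice_tau (Suc M) N)) + x\<^sup>2 + ((C ?a2 - C ?a0) / 3 + C ?a0)) * (lattice_tau (Suc M) N)\<^sup>2"
    unfolding solution_f_product(1)[OF sol] using lattice_tau_neq_0[of M N] by (simp add: add.assoc)
  moreover have "(C ?a2 - C ?a0) / 3 + C ?a0 = C ((?a2 - ?a0) / 3 + ?a0)"
    by (simp only: C_add C_diff C_div_3)
  ultimately have *: "lattice_tau (Suc (Suc M)) N * lattice_tau M N =
      (D (dlog (lattice_tau (Suc M) N)) + x\<^sup>2 + C ((?a2 - ?a0) / 3 + ?a0)) * (lattice_tau (Suc M) N)\<^sup>2"
    by (simp only:)
  have "of_nat (3 * Suc M) = [:of_nat (3 * Suc M) :: complex:]" by (rule of_nat_poly)
  then show ?thesis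
    using toda_cancel[OF lattice_tau_hermite lattice_tau_hermite lattice_tau_hermite hermite_neq_0 _ *,
        of "of_nat (3 * Suc M)"] by (simp only:) (simp add: field_simps del: mult_pCons_left)
qed

text \<open>Here the constant \<open>(a0 - a1)/3 - a0 = -2 - M - 2N\<close> plus the rate
  \<open>M - N - 1\<close> is \<open>-3(N + 1)\<close>.\<close>

lemma hermite_toda_right:
  "hermite M (Suc N) * pderiv (pderiv (hermite M (Suc N))) - (pderiv (hermite M (Suc N)))\<^sup>2
     - of_nat (3 * Suc N) * (hermite M (Suc N))\<^sup>2 = hermite M (Suc (Suc N)) * hermite M N"
proof -
  let ?a0 = "3 + 3 * of_nat M + 3 * of_nat N :: complex" and ?a1 = "- 3 * of_nat M :: complex"
  note sol = solution_lattice_state[of M N, unfolded lattice_state_eq]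
  have "lattice_tau M (Suc (Suc N)) =
      ((x + dlog (lattice_tau (Suc M) N) - dlog (lattice_tau M (Suc N))) *
        (x + dlog (lattice_tau M (Suc N)) - dlog (lattice_tau M N)) - C ?a0) *
        (lattice_tau M (Suc N))\<^sup>2 / lattice_tau M N"
    using move_U_eq[OF sol lattice_parameters_neq_0(1)] lattice_state_Suc_right[of M N]
    unfolding lattice_state_eq by simp
  then have "lattice_tau M (Suc (Suc N)) * lattice_tau M N =
      (D (dlog (lattice_tau M (Suc N))) + x\<^sup>2 + ((C ?a0 - C ?a1) / 3 - C ?a0)) * (lattice_tau M (Suc N))\<^sup>2"
    unfolding solution_f_product(2)[OF sol] using lattice_tau_neq_0[of M N] by (simp add: add_diff_eq)
  moreover have "(C ?a0 - C ?a1) / 3 - C ?a0 = C ((?a0 - ?a1) / 3 - ?a0)"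
    by (simp only: C_diff C_div_3)
  ultimately have *: "lattice_tau M (Suc (Suc N)) * lattice_tau M N =
      (D (dlog (lattice_tau M (Suc N))) + x\<^sup>2 + C ((?a0 - ?a1) / 3 - ?a0)) * (lattice_tau M (Suc N))\<^sup>2"
    by (simp only:)
  have "p - of_nat (3 * Suc N) * q = p + [:- of_nat (3 * Suc N):] * q" for p q :: "complex poly"
    unfolding of_nat_poly[of "3 * Suc N", where 'a = complex] by (simp flip: smult_minus_left)
  then show ?thesis
    using toda_cancel[OF lattice_tau_hermite lattice_tau_hermite lattice_tau_hermite hermite_neq_0 _ *,
        of "- of_nat (3 * Suc N)"] by (simp only:) (simp add: field_simps del: mult_pCons_left)
qed

lemma lattice_tau_seed:
  "lattice_tau 0 0 = E 0" "lattice_tau 1 0 = E 1" "lattice_tau 0 1 = E (- 1)"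
  using lattice_state_eq[of 0 0] by (simp_all add: lattice_state_def seed_state_def)

lemma hermite_initial:
  "hermite 0 0 = 1" "hermite 1 0 = 1" "hermite 0 1 = 1" "hermite 1 1 = [:0, 3:]"
proof -
  show "hermite 0 0 = 1" "hermite 1 0 = 1" "hermite 0 1 = 1"
    using lattice_tau_seed by (auto intro: hermite_eqI)
  \<comment> \<open>The last coordinate after one move to the right belongs to
    \<open>(1, 1)\<close>; the rates 1 and -1 give the factor \<open>x + x + x\<close>.\<close>
  have "lattice_tau (Suc 0) (Suc 0) = (x + dlog (E 1) - dlog (E (- 1))) * E 1 * E (- 1) / E 0"
    using move_R_eq[OF solution_lattice_state[of 0 0, unfolded lattice_state_eq] lattice_parameters_neq_0(1)]
      lattice_state_Suc_left[of 0 0]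
    unfolding lattice_state_eq by (simp add: lattice_tau_seed[unfolded One_nat_def])
  also have "\<dots> = (x + dlog (E 1) - dlog (E (- 1))) * E 0"
    using E_mult[of 1 "- 1" 0 0] by (simp add: mult.assoc)
  also have "x + dlog (E 1) - dlog (E (- 1)) = emb [:0, 3:]"
    using C_uminus[of 1] by (simp add: dlog_E emb_pCons)
  finally show "hermite 1 1 = [:0, 3:]" by (intro hermite_eqI) (simp add: mult.commute)
qed

end

subsection \<open>Power series of the seed\<close>

definition gaussian :: "complex \<Rightarrow> complex \<Rightarrow> complex" where
  "gaussian c z = exp (- (z ^ 4) / 12 + c / 2 * z\<^sup>2)"

definition gaussian_fps :: "complex \<Rightarrow> complex fps" where
  "gaussian_fps c = fps_expansion (gaussian c) 0"

lemma holomorphic_gaussian: "gaussian c holomorphic_on A"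
  unfolding gaussian_def by (intro holomorphic_intros) auto

lemma gaussian_has_fps_expansion: "gaussian c has_fps_expansion gaussian_fps c"
  unfolding gaussian_fps_def
  by (rule has_fps_expansion_fps_expansion[of UNIV]) (auto intro: holomorphic_gaussian)

lemma gaussian_fps_neq_0: "gaussian_fps c \<noteq> 0"
proof
  assume "gaussian_fps c = 0"
  then have "eval_fps 0 0 = gaussian c 0"
    using has_fps_expansion_imp_eval_fps_eq[OF gaussian_has_fps_expansion, of 0 1 c] holomorphic_gaussian by simp
  then show False by (simp add: gaussian_def)
qed

text \<open>The differential equation is checked on the entire function and transferred by
  uniqueness of the expansion.\<close>

lemma fps_deriv_gaussian_fps:
  "fps_deriv (gaussian_fps c) = (fps_const (- 1 / 3) * fps_X ^ 3 + fps_const c * fps_X) * gaussian_fps c"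
proof (rule fps_expansion_unique_complex)
  have "deriv (gaussian c) = (\<lambda>z. (- 1 / 3 * z ^ 3 + c * z) * gaussian c z)"
  proof
    fix z
    have "(gaussian c has_field_derivative (- 1 / 3 * z ^ 3 + c * z) * gaussian c z) (at z)"
      unfolding gaussian_def
      by (rule derivative_eq_intros refl | simp add: field_simps power_numeral_reduce)+
    then show "deriv (gaussian c) z = (- 1 / 3 * z ^ 3 + c * z) * gaussian c z"
      by (rule DERIV_imp_deriv)
  qed
  then show "deriv (gaussian c) has_fps_expansion
      (fps_const (- 1 / 3) * fps_X ^ 3 + fps_const c * fps_X) * gaussian_fps c"
    by (simp only:) (intro fps_expansion_intros gaussian_has_fps_expansion)
  show "deriv (gaussian c) has_fps_expansion fps_deriv (gaussian_fps c)"
    by (intro fps_expansion_intros gaussian_has_fps_expansion)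
qed

lemma gaussian_fps_mult:
  assumes "a + b = c + d"
  shows "gaussian_fps a * gaussian_fps b = gaussian_fps c * gaussian_fps d"
proof (rule fps_expansion_unique_complex)
  have "a / 2 * z\<^sup>2 + b / 2 * z\<^sup>2 = c / 2 * z\<^sup>2 + d / 2 * z\<^sup>2" for z
    unfolding distrib_right[symmetric] add_divide_distrib[symmetric] assms ..
  then have "gaussian a z * gaussian b z = gaussian c z * gaussian d z" for z
    unfolding gaussian_def exp_add[symmetric] by (simp add: algebra_simps)
  moreover have "(\<lambda>z. gaussian a z * gaussian b z) has_fps_expansion gaussian_fps a * gaussian_fps b"
    "(\<lambda>z. gaussian c z * gaussian d z) has_fps_expansion gaussian_fps c * gaussian_fps d"
    by (intro fps_expansion_intros gaussian_has_fps_expansion)+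
  ultimately show "(\<lambda>z. gaussian a z * gaussian b z) has_fps_expansion gaussian_fps a * gaussian_fps b"
    "(\<lambda>z. gaussian a z * gaussian b z) has_fps_expansion gaussian_fps c * gaussian_fps d"
    by simp_all
qed

text \<open>Entire functions do not form a field; their expansions at 0 live in Laurent series,
  where reflections may divide.\<close>

interpretation fls: differential_field fls_const fls_deriv "fls_X :: complex fls"
  by standard (simp_all add: fls_plus_const fls_const_mult_const)

interpretation fls: gaussian_field fls_const fls_deriv "fls_X :: complex fls"
  "\<lambda>p. fps_to_fls (fps_of_poly p)" "\<lambda>c. fps_to_fls (gaussian_fps c)"
proof
  show "fps_to_fls (gaussian_fps c) \<noteq> 0" for c
    by (simp add: gaussian_fps_neq_0)
  show "fps_to_fls (gaussian_fps a) * fps_to_fls (gaussian_fps b) =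
      fps_to_fls (gaussian_fps c) * fps_to_fls (gaussian_fps d)" if "a + b = c + d" for a b c d
    using gaussian_fps_mult[OF that] by (simp flip: fls_times_fps_to_fls)
  show "fls.dlog (fps_to_fls (gaussian_fps c)) = - (fls_X ^ 3) / 3 + fls_const c * fls_X" for c
  proof -
    have "fls_const (- 1 / 3) * 3 = (- 1 :: complex fls)"
      using fls.C_mult[of "- 1 / 3" 3] by simp
    then have "fls_const (- 1 / 3) = (- 1 / 3 :: complex fls)"
      by (simp add: field_simps)
    then show ?thesis
      by (simp add: fls.dlog_def fls_deriv_fps_to_fls fps_deriv_gaussian_fps gaussian_fps_neq_0
          fls_times_fps_to_fls fps_to_fls_power)
  qed
qed (simp_all add: fps_of_poly_const fps_of_poly_add fps_of_poly_mult fps_of_poly_pderiv fls_deriv_fps_to_fls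
    fls_times_fps_to_fls fps_of_poly_eq_iff)

section \<open>From formal series back to entire functions\<close>

lemma complex_algebra_ident: "complex_algebra (\<lambda>c. c)"
  by standard simp_all

lemma seed_eval_simps:
  "seed_eval (mconst c) = (\<lambda>_. c)" "seed_eval (mvar v) = seed v"
  "seed_eval (p + q) = (\<lambda>z. seed_eval p z + seed_eval q z)"
  "seed_eval (p * q) = (\<lambda>z. seed_eval p z * seed_eval q z)"
  unfolding seed_eval_def
  by (simp_all only: complex_algebra.peval_mconst[OF complex_algebra_ident]
      complex_algebra.peval_mvar[OF complex_algebra_ident]
      complex_algebra.peval_add[OF complex_algebra_ident] complex_algebra.peval_mult[OF complex_algebra_ident])

text \<open>The expansion at 0 of an entire function represents it on every disc, so it determines
  the value at each \<open>z\<close>.\<close>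

lemma entire_eq_of_fps_expansion:
  assumes "f has_fps_expansion F" "g has_fps_expansion F" "f holomorphic_on UNIV" "g holomorphic_on UNIV"
  shows "f z = g z"
proof -
  have "f holomorphic_on ball 0 (norm z + 1)" "g holomorphic_on ball 0 (norm z + 1)"
    using assms(3,4) by (auto intro: holomorphic_on_subset)
  then have "eval_fps F z = f z" "eval_fps F z = g z"
    using assms(1,2) by (auto intro: has_fps_expansion_imp_eval_fps_eq[of _ _ z "norm z + 1"])
  then show ?thesis by simp
qed

lemma seed_tau_eq: "seed_tau 0 = gaussian 0" "seed_tau 1 = gaussian 1" "seed_tau 2 = gaussian (- 1)"
  by (auto simp: gaussian_def fun_eq_iff)

text \<open>Links the formal point with the analytic seed: the formal value of a polynomial is the
  expansion of its evaluation. Being entire is recorded so that identities can be carried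
  back.\<close>

lemma seed_eval_expansion:
  "\<exists>F. peval fls_const (fls.point fls.seed_state) p = fps_to_fls F \<and>
     seed_eval p has_fps_expansion F \<and> seed_eval p holomorphic_on UNIV"
proof (induction p rule: mpoly_induct)
  case (const c)
  show ?case by (intro exI[of _ "fps_const c"]) (simp add: seed_eval_simps)
next
  case (var v)
  have seed: "seed A0 = (\<lambda>_. 3)" "seed A1 = (\<lambda>_. 0)" "seed X = (\<lambda>z. z)"
    "seed T0 = gaussian 0" "seed T1 = gaussian 1" "seed T2 = gaussian (- 1)"
    "seed DT0 = deriv (gaussian 0)" "seed DT1 = deriv (gaussian 1)" "seed DT2 = deriv (gaussian (- 1))"
    by (simp_all add: fun_eq_iff seed_tau_eq del: seed_tau.simps One_nat_def)
  have g: "gaussian c has_fps_expansion gaussian_fps c" "deriv (gaussian c) has_fps_expansion fps_deriv (gaussian_fps c)"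
    "gaussian c holomorphic_on UNIV" "deriv (gaussian c) holomorphic_on UNIV" for c
    by (auto intro!: gaussian_has_fps_expansion fps_expansion_intros holomorphic_gaussian holomorphic_deriv)
  define F where "F = (case v of A0 \<Rightarrow> fps_const 3 | A1 \<Rightarrow> fps_const 0 | X \<Rightarrow> fps_X
    | T0 \<Rightarrow> gaussian_fps 0 | T1 \<Rightarrow> gaussian_fps 1 | T2 \<Rightarrow> gaussian_fps (- 1)
    | DT0 \<Rightarrow> fps_deriv (gaussian_fps 0) | DT1 \<Rightarrow> fps_deriv (gaussian_fps 1)
    | DT2 \<Rightarrow> fps_deriv (gaussian_fps (- 1)))"
  have "fls.point fls.seed_state v = fps_to_fls F"
    by (cases v) (simp_all only: fls.seed_state_def fls.point.simps F_def var.case fps_const_to_fls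
      fps_X_to_fls fls_deriv_fps_to_fls)
  moreover have "seed v has_fps_expansion F"
    by (cases v) (simp_all only: seed F_def var.case g has_fps_expansion_const has_fps_expansion_fps_X)
  moreover have "seed v holomorphic_on UNIV"
    by (cases v) (simp_all only: seed g holomorphic_on_const holomorphic_on_ident)
  ultimately show ?case
    unfolding seed_eval_simps fls.peval_mvar by blast
next
  case (add p q)
  then obtain F G where "peval fls_const (fls.point fls.seed_state) p = fps_to_fls F"
    "seed_eval p has_fps_expansion F" "seed_eval p holomorphic_on UNIV"
    "peval fls_const (fls.point fls.seed_state) q = fps_to_fls G"
    "seed_eval q has_fps_expansion G" "seed_eval q holomorphic_on UNIV" by blast
  then show ?case
    unfolding seed_eval_simps
    by (intro exI[of _ "F + G"] conjI fps_expansion_intros holomorphic_intros) (simp_all add: fls.peval_add)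
next
  case (mult p q)
  then obtain F G where "peval fls_const (fls.point fls.seed_state) p = fps_to_fls F"
    "seed_eval p has_fps_expansion F" "seed_eval p holomorphic_on UNIV"
    "peval fls_const (fls.point fls.seed_state) q = fps_to_fls G"
    "seed_eval q has_fps_expansion G" "seed_eval q holomorphic_on UNIV" by blast
  then show ?case
    unfolding seed_eval_simps
    by (intro exI[of _ "F * G"] conjI fps_expansion_intros holomorphic_intros)
      (simp_all add: fls.peval_mult fls_times_fps_to_fls)
qed

text \<open>Clearing the denominator gives an identity of power series, hence of entire functions at
  every point. A denominator with nonzero expansion cannot vanish identically.\<close>

lemma eval_seed_is_of_has_value:
  assumes "fls.has_value (fls.point fls.seed_state) q (fps_to_fls (gaussian_fps c) * fps_to_fls (fps_of_poly h))"
  shows "eval_seed_is q (\<lambda>z. gaussian c z * poly h z)"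
proof -
  obtain a b where ab: "q = Fraction_Field.Fract a b" "peval fls_const (fls.point fls.seed_state) b \<noteq> 0"
    "fps_to_fls (gaussian_fps c) * fps_to_fls (fps_of_poly h) * peval fls_const (fls.point fls.seed_state) b =
      peval fls_const (fls.point fls.seed_state) a"
    using assms unfolding fls.has_value_def by blast
  obtain A where A: "peval fls_const (fls.point fls.seed_state) a = fps_to_fls A"
    "seed_eval a has_fps_expansion A" "seed_eval a holomorphic_on UNIV"
    using seed_eval_expansion by blast
  obtain B where B: "peval fls_const (fls.point fls.seed_state) b = fps_to_fls B"
    "seed_eval b has_fps_expansion B" "seed_eval b holomorphic_on UNIV"
    using seed_eval_expansion by blast
  have "gaussian_fps c * fps_of_poly h * B = A"
    using ab(3) by (simp add: A(1) B(1) flip: fls_times_fps_to_fls)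
  moreover have "poly h has_fps_expansion fps_of_poly h"
    by (simp add: has_fps_expansion_def)
  ultimately have "(\<lambda>z. gaussian c z * poly h z * seed_eval b z) has_fps_expansion A"
    using gaussian_has_fps_expansion B(2) by (auto intro!: fps_expansion_intros)
  moreover have "(\<lambda>z. gaussian c z * poly h z * seed_eval b z) holomorphic_on UNIV"
    by (intro holomorphic_intros holomorphic_gaussian B(3))
  ultimately have "seed_eval a z = gaussian c z * poly h z * seed_eval b z" for z
    using entire_eq_of_fps_expansion[OF A(2) _ A(3)] by blast
  moreover have "\<exists>z. seed_eval b z \<noteq> 0"
  proof (rule ccontr)
    assume "\<nexists>z. seed_eval b z \<noteq> 0"
    then have "seed_eval b = (\<lambda>_. 0)" by auto
    then have "B = 0" using B(2) by (auto intro: fps_expansion_unique_complex)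
    then show False using ab(2) B(1) by simp
  qed
  ultimately show ?thesis unfolding eval_seed_is_def using ab(1) by blast
qed

subsection \<open>The generalized Hermite polynomials\<close>

text \<open>The second Toda equation propagates the four initial values along the columns
  \<open>m = 0\<close> and \<open>m = 1\<close>; the first then extends these to all
  \<open>m\<close>. Each step cancels the nonzero \<open>H m n\<close>, with which
  \<open>G m n\<close> already agrees.\<close>

lemma toda_hermite_unique:
  assumes "toda_hermite G" "hermite_init G" "toda_hermite H" "hermite_init H" "\<And>m n. H m n \<noteq> 0"
  shows "G = H"
proof -
  have left: "K (Suc (Suc m)) n * K m n = K (Suc m) n * pderiv (pderiv (K (Suc m) n)) - (pderiv (K (Suc m) n))\<^sup>2
      + of_nat (3 * Suc m) * (K (Suc m) n)\<^sup>2" if "toda_hermite K" for K m n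
  proof -
    have "K (Suc m) n * pderiv (pderiv (K (Suc m) n)) - (pderiv (K (Suc m) n))\<^sup>2
        + of_nat (3 * Suc m) * (K (Suc m) n)\<^sup>2 = K (Suc m + 1) n * K (Suc m - 1) n"
      by (rule that[unfolded toda_hermite_def, THEN conjunct1, rule_format]) simp
    then show ?thesis unfolding Suc_eq_plus1[symmetric] diff_Suc_1 by (rule sym)
  qed
  have right: "K m (Suc (Suc n)) * K m n = K m (Suc n) * pderiv (pderiv (K m (Suc n))) - (pderiv (K m (Suc n)))\<^sup>2
      - of_nat (3 * Suc n) * (K m (Suc n))\<^sup>2" if "toda_hermite K" for K m n
  proof -
    have "K m (Suc n) * pderiv (pderiv (K m (Suc n))) - (pderiv (K m (Suc n)))\<^sup>2
        - of_nat (3 * Suc n) * (K m (Suc n))\<^sup>2 = K m (Suc n + 1) * K m (Suc n - 1)"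
      by (rule that[unfolded toda_hermite_def, THEN conjunct2, rule_format]) simp
    then show ?thesis unfolding Suc_eq_plus1[symmetric] diff_Suc_1 by (rule sym)
  qed
  have column: "G m n = H m n" if "G m 0 = H m 0" "G m 1 = H m 1" for m n
  proof (induction n rule: induct_nat_012)
    case (ge2 n)
    then have "G m (Suc (Suc n)) * H m n = H m (Suc (Suc n)) * H m n"
      using right[OF assms(1), of m n] right[OF assms(3), of m n] by (simp only:)
    then show ?case using assms(5)[of m n] by simp
  qed (use that in simp_all)
  have init: "G 0 0 = H 0 0" "G 0 1 = H 0 1" "G 1 0 = H 1 0" "G 1 1 = H 1 1"
    using assms(2,4) unfolding hermite_init_def by metis+
  have base: "G 0 n = H 0 n" "G (Suc 0) n = H (Suc 0) n" for n
    using column[OF init(1,2)] column[OF init(3,4)] by simp_all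
  have "G m n = H m n" for m n
  proof (induction m rule: induct_nat_012)
    case (ge2 m)
    then have "G (Suc (Suc m)) n * H m n = H (Suc (Suc m)) n * H m n"
      using left[OF assms(1), of m n] left[OF assms(3), of m n] by (simp only:)
    then show ?case using assms(5)[of m n] by simp
  qed (use base in simp_all)
  then show ?thesis by blast
qed

theorem theorem4p4:
  "\<exists>H :: nat \<Rightarrow> nat \<Rightarrow> complex poly.
     (\<forall>m n. n \<le> m \<longrightarrow>
        eval_seed_is (tau_mn m n)
          (\<lambda>x. exp (- (x^4) / 12 + (of_nat m - 2 * of_nat n) / 2 * x^2) * poly (H (m - n) n) x)) \<and>
     toda_hermite H \<and> hermite_init H \<and>
     (\<forall>G. toda_hermite G \<and> hermite_init G \<longrightarrow> G = H)"
proof (intro exI[of _ fls.hermite] conjI allI impI)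
  fix m n :: nat
  assume "n \<le> m"
  \<comment> \<open>The lattice rate \<open>M - N\<close> at \<open>M = m - n\<close> and
    \<open>N = n\<close>.\<close>
  then have c: "of_nat (m - n) - of_nat n = (of_nat m - 2 * of_nat n :: complex)" by (simp add: of_nat_diff)
  show "eval_seed_is (tau_mn m n)
      (\<lambda>x. exp (- (x^4) / 12 + (of_nat m - 2 * of_nat n) / 2 * x^2) * poly (fls.hermite (m - n) n) x)"
    using eval_seed_is_of_has_value[OF fls.has_value_tau_mn[OF \<open>n \<le> m\<close>, unfolded fls.lattice_tau_hermite]]
    by (simp only: c gaussian_def)
next
  show toda: "toda_hermite fls.hermite"
    unfolding toda_hermite_def
  proof (intro conjI allI impI)
    fix m n :: nat
    assume "1 \<le> m"
    then obtain k where "m = Suc k" by (cases m) auto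
    then show "fls.hermite m n * pderiv (pderiv (fls.hermite m n)) - (pderiv (fls.hermite m n))\<^sup>2
        + of_nat (3 * m) * (fls.hermite m n)\<^sup>2 = fls.hermite (m + 1) n * fls.hermite (m - 1) n"
      using fls.hermite_toda_left[of k n] by simp
  next
    fix m n :: nat
    assume "1 \<le> n"
    then obtain k where "n = Suc k" by (cases n) auto
    then show "fls.hermite m n * pderiv (pderiv (fls.hermite m n)) - (pderiv (fls.hermite m n))\<^sup>2
        - of_nat (3 * n) * (fls.hermite m n)\<^sup>2 = fls.hermite m (n + 1) * fls.hermite m (n - 1)"
      using fls.hermite_toda_right[of m k] by simp
  qed
  show init: "hermite_init fls.hermite"
    using fls.hermite_initial by (simp add: hermite_init_def)
  show "G = fls.hermite" if "toda_hermite G \<and> hermite_init G" for G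
    using that toda init by (intro toda_hermite_unique) simp_all
qed

end
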